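(* Let $1\le p<\infty$ and $\mathbf{w}\in\mathcal{W}$. Then $g(\mathbf{w},p)$ has a (conditional) Schauder basis $\mathcal{B}$ with $L_m[\mathcal{B}]\approx m$ for $m\in\mathbb{N}$.
   Context: Scalars are in $\mathbb{F}=\mathbb{R}$ or $\mathbb{C}$. $\mathcal{W}$ denotes the set of weights $\mathbf{w}=(w_j)_{j=1}^\infty\in c_0\setminus\ell_1$ with $1=w_1\ge w_2\ge\cdots\ge w_j\ge w_{j+1}\ge\cdots>0$. Let $\mathcal{O}$ be the set of all (strictly) increasing functions from $\mathbb{N}=\{1,2,\dots\}$ to $\mathbb{N}$. For $1\le p<\infty$ and $\mathbf{w}\in\mathcal{W}$, the Garling sequence space $g(\mathbf{w},p)$ is the Banach space of all scalar sequences $f=(a_j)_{j=1}^\infty$ such that $$\|f\|_{g(\mathbf{w},p)}=\sup_{\phi\in\mathcal{O}}\left(\sum_{j=1}^\infty |a_{\phi(j)}|^p w_j\right)^{1/p}<\infty.$$ A basis is conditional if it is not unconditional. Given a (Schauder) basis $\mathcal{B}=(\mathbf{x}_j)_{j=1}^\infty$ of a Banach space $\mathbb{X}$ and $f=\sum_{j=1}^\infty a_j\mathbf{x}_j\in\mathbb{X}$, let $\operatorname{supp}(f)=\{j: a_j\ne0\}$, and for $A\subseteq\mathbb{N}$ let $S_A(f)=\sum_{j\in A}a_j\mathbf{x}_j$ denote the coordinate projection on $A$. For $m\in\mathbb{N}$, $$L_m[\mathcal{B}]=\sup\left\{\frac{\|S_A(f)\|}{\|f\|}: 0\neq f\in\mathbb{X},\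 \operatorname{supp}(f)\subseteq[1,m],\ A\subseteq\mathbb{N}\right\}.$$ For families of non-negative numbers, $\alpha_m\approx\beta_m$ for $m\in\mathbb{N}$ means that there is a constant $0<C<\infty$ with $\alpha_m\le C\beta_m$ and $\beta_m\le C\alpha_m$ for all $m\in\mathbb{N}$. *)

theory Defs
  imports Complex_Main "HOL-Library.Extended_Nonnegative_Real"
begin

text \<open>
  Sequences are functions on \<open>nat\<close>; index \<open>j\<close> plays the role of index \<open>j + 1\<close> in
  \<open>{1, 2, \<dots>}\<close>. In particular the interval \<open>[1, m]\<close> becomes \<open>{..<m}\<close>.
\<close>

definition weight :: "(nat \<Rightarrow> real) \<Rightarrow> bool" where
  "weight w \<longleftrightarrow> w 0 = 1 \<and> decseq w \<and> (\<forall>j. 0 < w j) \<and> w \<longlonglongrightarrow> 0 \<and> \<not> summable w"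

definition garling_space :: "(nat \<Rightarrow> real) \<Rightarrow> real \<Rightarrow> (nat \<Rightarrow> 'a::real_normed_field) set" where
  "garling_space w p =
     {f. (\<forall>\<phi>::nat \<Rightarrow> nat. strict_mono \<phi> \<longrightarrow> summable (\<lambda>j. norm (f (\<phi> j)) powr p * w j)) \<and>
         bdd_above ((\<lambda>\<phi>. (\<Sum>j. norm (f (\<phi> j)) powr p * w j) powr (1 / p)) `
           {\<phi>::nat \<Rightarrow> nat. strict_mono \<phi>})}"

text \<open>Meaningful only on \<^const>\<open>garling_space\<close>, where the series and the supremum are finite.\<close>

definition garling_norm :: "(nat \<Rightarrow> real) \<Rightarrow> real \<Rightarrow> (nat \<Rightarrow> 'a::real_normed_field) \<Rightarrow> real" where
  "garling_norm w p f =
     (SUP \<phi>\<in>{\<phi>::nat \<Rightarrow> nat. strict_mono \<phi>}.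
        (\<Sum>j. norm (f (\<phi> j)) powr p * w j) powr (1 / p))"

text \<open>
  Below, \<open>X\<close> is the carrier of a Banach space of scalar sequences (with coordinatewise
  operations), \<open>N\<close> is its norm, and \<open>B j\<close> is the \<open>j\<close>-th vector of a sequence in \<open>X\<close>.
\<close>

definition series_converges_to ::
  "((nat \<Rightarrow> 'a::real_normed_field) \<Rightarrow> real) \<Rightarrow> (nat \<Rightarrow> nat \<Rightarrow> 'a) \<Rightarrow> (nat \<Rightarrow> 'a) \<Rightarrow> bool" where
  "series_converges_to N u f \<longleftrightarrow> (\<lambda>n. N (\<lambda>k. f k - (\<Sum>j<n. u j k))) \<longlonglongrightarrow> 0"

definition is_expansion ::
  "((nat \<Rightarrow> 'a::real_normed_field) \<Rightarrow> real) \<Rightarrow> (nat \<Rightarrow> nat \<Rightarrow> 'a) \<Rightarrow> (nat \<Rightarrow> 'a) \<Rightarrow> (nat \<Rightarrow> 'a) \<Rightarrow> bool"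
  where "is_expansion N B f a \<longleftrightarrow> series_converges_to N (\<lambda>j k. a j * B j k) f"

definition schauder_basis ::
  "(nat \<Rightarrow> 'a::real_normed_field) set \<Rightarrow> ((nat \<Rightarrow> 'a) \<Rightarrow> real) \<Rightarrow> (nat \<Rightarrow> nat \<Rightarrow> 'a) \<Rightarrow> bool" where
  "schauder_basis X N B \<longleftrightarrow> (\<forall>j. B j \<in> X) \<and> (\<forall>f\<in>X. \<exists>!a. is_expansion N B f a)"

definition coeffs ::
  "((nat \<Rightarrow> 'a::real_normed_field) \<Rightarrow> real) \<Rightarrow> (nat \<Rightarrow> nat \<Rightarrow> 'a) \<Rightarrow> (nat \<Rightarrow> 'a) \<Rightarrow> nat \<Rightarrow> 'a" where
  "coeffs N B f = (THE a. is_expansion N B f a)"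

text \<open>Every rearrangement of the expansion of every vector of \<open>X\<close> converges in \<open>X\<close>.\<close>

definition unconditional_basis ::
  "(nat \<Rightarrow> 'a::real_normed_field) set \<Rightarrow> ((nat \<Rightarrow> 'a) \<Rightarrow> real) \<Rightarrow> (nat \<Rightarrow> nat \<Rightarrow> 'a) \<Rightarrow> bool" where
  "unconditional_basis X N B \<longleftrightarrow> schauder_basis X N B \<and>
     (\<forall>f\<in>X. \<forall>\<pi>::nat \<Rightarrow> nat. bij \<pi> \<longrightarrow>
        (\<exists>g\<in>X. series_converges_to N (\<lambda>j k. coeffs N B f (\<pi> j) * B (\<pi> j) k) g))"

definition conditional_basis ::
  "(nat \<Rightarrow> 'a::real_normed_field) set \<Rightarrow> ((nat \<Rightarrow> 'a) \<Rightarrow> real) \<Rightarrow> (nat \<Rightarrow> nat \<Rightarrow> 'a) \<Rightarrow> bool" where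
  "conditional_basis X N B \<longleftrightarrow> schauder_basis X N B \<and> \<not> unconditional_basis X N B"

definition supp ::
  "((nat \<Rightarrow> 'a::real_normed_field) \<Rightarrow> real) \<Rightarrow> (nat \<Rightarrow> nat \<Rightarrow> 'a) \<Rightarrow> (nat \<Rightarrow> 'a) \<Rightarrow> nat set" where
  "supp N B f = {j. coeffs N B f j \<noteq> 0}"

text \<open>
  Only used for vectors \<open>f\<close> of finite support, so that the sum is finite for arbitrary \<open>A\<close>.
\<close>

definition coord_proj ::
  "((nat \<Rightarrow> 'a::real_normed_field) \<Rightarrow> real) \<Rightarrow> (nat \<Rightarrow> nat \<Rightarrow> 'a) \<Rightarrow> nat set \<Rightarrow> (nat \<Rightarrow> 'a) \<Rightarrow> (nat \<Rightarrow> 'a)"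
  where "coord_proj N B A f = (\<lambda>k. \<Sum>j\<in>A \<inter> supp N B f. coeffs N B f j * B j k)"

text \<open>The supremum is taken in \<^typ>\<open>ennreal\<close>, so it is meaningful without a boundedness proof.\<close>

definition L_const ::
  "(nat \<Rightarrow> 'a::real_normed_field) set \<Rightarrow> ((nat \<Rightarrow> 'a) \<Rightarrow> real) \<Rightarrow> (nat \<Rightarrow> nat \<Rightarrow> 'a) \<Rightarrow> nat \<Rightarrow> ennreal"
  where
  "L_const X N B m =
     Sup {ennreal (N (coord_proj N B A f) / N f) | f A.
            f \<in> X \<and> f \<noteq> (\<lambda>_. 0) \<and> supp N B f \<subseteq> {..<m}}"

text \<open>Here \<open>m\<close> is a cardinality rather than an index, so it ranges over \<open>m \<ge> 1\<close> unshifted.\<close>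

definition equivalent_families :: "(nat \<Rightarrow> ennreal) \<Rightarrow> (nat \<Rightarrow> ennreal) \<Rightarrow> bool" where
  "equivalent_families \<alpha> \<beta> \<longleftrightarrow>
     (\<exists>C::real. 0 < C \<and> (\<forall>m\<ge>1. \<alpha> m \<le> ennreal C * \<beta> m \<and> \<beta> m \<le> ennreal C * \<alpha> m))"

end

theory Submission
  imports Defs "HOL-Analysis.Convex" "HOL-Library.Infinite_Set" "HOL-Library.Discrete_Functions"
    "HOL-Library.Disjoint_Sets"
begin

text \<open>
  The space contains uniform copies of the finite-dimensional spaces with the maximum norm. Take
  consecutive intervals of coordinates whose lengths decrease rapidly, and let \<open>u\<^sub>i\<close> be the
  normalized indicator of the \<open>i\<close>-th one. A set of coordinates that uses a substantial part of one
  interval has spent the large weights before it reaches the next, much shorter intervals, while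
  its earlier elements lie too thinly in much longer intervals to count. Hence the norm of
  \<open>\<Sum>a\<^sub>iu\<^sub>i\<close> is comparable to the largest \<open>\<bar>a\<^sub>i\<bar>\<close> (\<open>N_block_sum_group\<close>). In a maximum norm the
  summing vectors \<open>s\<^sub>i = u\<^sub>i + u\<^sub>i\<^sub>+\<^sub>1 + \<dots>\<close> form a basis as conditional as possible: an
  alternating sum of them has coordinates 0 and 1, while the sum of its positive terms has norm
  proportional to their number.

  To get a basis of the whole space, all of \<open>\<nat>\<close> is partitioned into intervals, arranged in groups
  of \<open>2 ^ n\<close> intervals with decreasing lengths. Averaging over the intervals is a bounded
  projection (\<open>N_averaging\<close>), because it is a mean of simultaneous cyclic rotations and a rotation
  is the union of two increasing maps, under which the norm does not grow. The range of the
  projection is spanned by the \<open>u\<^sub>i\<close>, and there the summing vectors of each group are used. Its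
  kernel consists of the sequences with mean zero on each interval. It has the basis of vectors
  \<open>e\<^sub>j - (mean of the e\<^sub>i with i > j in the same interval)\<close>, and the partial sums of that basis
  are differences of two averaging operators (\<open>sum_diff_vec\<close>). So the vectors of both kinds may be
  interleaved without losing uniform boundedness of the partial sums (\<open>N_partial_sum\<close>), and taking
  them alternately puts a full group of summing vectors with a fixed share of the indices into
  every initial segment. This gives the lower bound for the growth; the upper bound holds for any
  basis with bounded vectors and coefficient functionals. Convergence of the expansions rests on
  the density of the finitely supported sequences (\<open>N_tail_tendsto\<close>).

  For conditionality, the alternating sums of the groups are added with weights \<open>(1/2) ^ n\<close>. A
  permutation that moves the terms with positive sign to the front of each group produces blocks
  of norm at least \<open>1/4\<close> arbitrarily far out.
\<close>

section \<open>The Garling norm through finite sets of coordinates\<close>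

definition rank_in :: "nat set \<Rightarrow> nat \<Rightarrow> nat" where
  "rank_in A a = card (A \<inter> {..<a})"

lemma rank_in_subset: "A \<subseteq> B \<Longrightarrow> rank_in A a \<le> rank_in B a"
  unfolding rank_in_def by (intro card_mono) auto

lemma rank_in_image:
  assumes "strict_mono_on S \<psi>" and "A \<subseteq> S" and "a \<in> S"
  shows "rank_in (\<psi> ` A) (\<psi> a) = rank_in A a"
proof -
  have "\<psi> ` A \<inter> {..<\<psi> a} = \<psi> ` (A \<inter> {..<a})"
    using assms by (auto simp: strict_mono_on_less)
  moreover have "inj_on \<psi> (A \<inter> {..<a})"
    using assms by (meson inf.coboundedI1 inj_on_subset strict_mono_on_imp_inj_on)
  ultimately show ?thesis
    unfolding rank_in_def by (simp add: card_image)
qed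

lemma enumerate_initial_segment:
  assumes "infinite (S :: nat set)"
  shows "S \<inter> {..<enumerate S n} = enumerate S ` {..<n}"
proof (intro equalityI subsetI)
  fix x assume x: "x \<in> S \<inter> {..<enumerate S n}"
  then obtain m where "x = enumerate S m"
    using enumerate_Ex[of S x] assms by auto
  with x assms show "x \<in> enumerate S ` {..<n}" by auto
qed (use assms enumerate_in_set in auto)

lemma rank_in_enumerate:
  assumes "infinite S"
  shows "rank_in S (enumerate S n) = n"
  unfolding rank_in_def enumerate_initial_segment[OF assms] using inj_enumerate[OF assms]
  by (simp add: card_image inj_on_subset)

lemma rank_in_less:
  "finite A \<Longrightarrow> a \<in> A \<Longrightarrow> a < b \<Longrightarrow> rank_in A a < rank_in A b"
  unfolding rank_in_def by (rule psubset_card_mono) auto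

lemma inj_on_rank_in:
  assumes "finite A"
  shows "inj_on (rank_in A) A"
proof (rule inj_onI)
  fix x y assume "x \<in> A" "y \<in> A" "rank_in A x = rank_in A y"
  with rank_in_less[OF assms, of x y] rank_in_less[OF assms, of y x] show "x = y"
    by (cases x y rule: linorder_cases) auto
qed

lemma bij_betw_rank_in:
  assumes "finite A"
  shows "bij_betw (rank_in A) A {..<card A}"
proof -
  have "rank_in A ` A \<subseteq> {..<card A}"
  proof (clarsimp simp: rank_in_def)
    fix x assume "x \<in> A"
    then show "card (A \<inter> {..<x}) < card A" using assms by (intro psubset_card_mono) auto
  qed
  moreover have "card (rank_in A ` A) = card A" using inj_on_rank_in[OF assms] by (rule card_image)
  ultimately have "rank_in A ` A = {..<card A}" by (intro card_subset_eq) auto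
  with inj_on_rank_in[OF assms] show ?thesis by (simp add: bij_betw_def)
qed

lemma sum_rank_in:
  "finite A \<Longrightarrow> (\<Sum>a\<in>A. v (rank_in A a)) = (\<Sum>i<card A. v i)"
  by (rule sum.reindex_bij_betw[OF bij_betw_rank_in])

text \<open>
  Deleting the first elements of \<open>F\<close>, as many as \<open>A\<close> has, makes room for \<open>A\<close>: what is left of \<open>F\<close>
  can be placed behind \<open>A\<close> without any rank going up.
\<close>

lemma rank_in_append:
  assumes "finite A" "finite F" and F': "F' = {x \<in> F. card A \<le> rank_in F x}" and a: "a \<in> F'"
  shows "rank_in (A \<union> F') a \<le> rank_in F a"
proof -
  have "card (F' \<inter> {..<a}) = card (rank_in F ` (F' \<inter> {..<a}))"
    by (intro card_image[symmetric] inj_on_subset[OF inj_on_rank_in[OF \<open>finite F\<close>]]) (auto simp: F')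
  also have "\<dots> \<le> card {card A..<rank_in F a}"
    by (intro card_mono) (auto simp: F' intro!: rank_in_less[OF \<open>finite F\<close>])
  finally have "card (F' \<inter> {..<a}) \<le> rank_in F a - card A" by simp
  moreover have "rank_in (A \<union> F') a \<le> card A + card (F' \<inter> {..<a})"
    unfolding rank_in_def using assms
    by (intro order_trans[OF card_mono card_Un_le[of A "F' \<inter> {..<a}"]]) auto
  moreover have "card A \<le> rank_in F a" using a by (simp add: F')
  ultimately show ?thesis by linarith
qed

locale garling_weight =
  fixes w :: "nat \<Rightarrow> real" and p :: real
  assumes p: "1 \<le> p" and w: "weight w"
begin

lemma w0: "w 0 = 1" and w_mono: "i \<le> j \<Longrightarrow> w j \<le> w i" and w_pos: "0 < w j"
  and w_lim: "w \<longlonglongrightarrow> 0" and w_not_summable: "\<not> summable w"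
  using w by (auto simp: weight_def decseq_def)

lemma w_nonneg: "0 \<le> w j" using w_pos[of j] by simp

abbreviation X :: "(nat \<Rightarrow> 'a::real_normed_field) set" where
  "X \<equiv> garling_space w p"

abbreviation N :: "(nat \<Rightarrow> 'a::real_normed_field) \<Rightarrow> real" where
  "N \<equiv> garling_norm w p"

text \<open>
  The norm to the power \<open>p\<close> is the supremum of these sums over all finite \<open>A\<close>: an increasing
  enumeration gives the element of \<open>A\<close> preceded by \<open>j\<close> others the weight \<open>w j\<close>. In this form,
  changes of the selected coordinates can be followed without handling enumerations; the two
  directions are \<open>garling_boundI\<close> and \<open>wsum_le_N\<close>.
\<close>

definition wsum :: "(nat \<Rightarrow> 'a::real_normed_field) \<Rightarrow> nat set \<Rightarrow> real" where
  "wsum f A = (\<Sum>a\<in>A. norm (f a) powr p * w (rank_in A a))"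

lemma wsum_nonneg: "0 \<le> wsum f A"
  unfolding wsum_def using w_nonneg by (intro sum_nonneg) auto

lemma wsum_cong:
  "(\<And>a. a \<in> A \<Longrightarrow> norm (f a) = norm (g a)) \<Longrightarrow> wsum f A = wsum g A"
  unfolding wsum_def by (intro sum.cong) auto

lemma p_pos: "0 < p" using p by simp

lemma powr_p_root: "0 \<le> x \<Longrightarrow> (x powr p) powr (1/p) = x"
  by (simp add: powr_powr p_pos[THEN less_imp_neq, symmetric])

lemma root_powr_p: "0 \<le> x \<Longrightarrow> (x powr (1/p)) powr p = x"
  by (simp add: powr_powr p_pos[THEN less_imp_neq, symmetric])

lemma powr_p_mono: "0 \<le> x \<Longrightarrow> x \<le> y \<Longrightarrow> x powr p \<le> y powr p"
  using p by (intro powr_mono2) auto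

lemma powr_p_le_iff:
  "0 \<le> x \<Longrightarrow> 0 \<le> y \<Longrightarrow> x powr p \<le> y powr p \<longleftrightarrow> x \<le> y"
  using p_pos powr_less_mono2[of p y x] powr_p_mono[of x y] by (meson not_less)

lemma wsum_enumeration:
  assumes "strict_mono \<phi>"
  shows "wsum f (\<phi> ` {..<n}) = (\<Sum>j<n. norm (f (\<phi> j)) powr p * w j)"
proof -
  have "inj_on \<phi> {..<n}" using assms strict_mono_imp_inj_on inj_on_subset by blast
  moreover have "rank_in (\<phi> ` {..<n}) (\<phi> j) = j" if "j < n" for j
  proof -
    have "\<phi> ` {..<n} \<inter> {..<\<phi> j} = \<phi> ` {..<j}"
      using assms that by (auto simp: strict_mono_less)
    then show ?thesis
      using assms by (simp add: rank_in_def card_image strict_mono_imp_inj_on inj_on_subset)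
  qed
  ultimately show ?thesis by (simp add: wsum_def sum.reindex)
qed

lemma garling_boundI:
  assumes "0 \<le> C" and bd: "\<And>A. finite A \<Longrightarrow> wsum f A \<le> C powr p"
  shows "f \<in> X" and "N f \<le> C"
proof -
  have part: "(\<Sum>j<n. norm (f (\<phi> j)) powr p * w j) \<le> C powr p" if "strict_mono \<phi>" for \<phi> n
    using bd[of "\<phi> ` {..<n}"] wsum_enumeration[OF that, of f n] by simp
  have sm: "summable (\<lambda>j. norm (f (\<phi> j)) powr p * w j)" if "strict_mono \<phi>" for \<phi>
    by (rule summableI_nonneg_bounded[OF _ part[OF that]]) (simp add: w_nonneg)
  have le: "(\<Sum>j. norm (f (\<phi> j)) powr p * w j) powr (1/p) \<le> C" if "strict_mono \<phi>" for \<phi>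
  proof -
    have "(\<Sum>j. norm (f (\<phi> j)) powr p * w j) \<le> C powr p"
      by (rule suminf_le_const[OF sm[OF that] part[OF that]])
    then have "(\<Sum>j. norm (f (\<phi> j)) powr p * w j) powr (1/p) \<le> (C powr p) powr (1/p)"
      using p by (intro powr_mono2 suminf_nonneg sm that) (auto simp: w_nonneg)
    then show ?thesis by (simp add: powr_p_root assms)
  qed
  then show "f \<in> X" unfolding garling_space_def bdd_above_def using sm by auto
  have "strict_mono (id :: nat \<Rightarrow> nat)" by (simp add: strict_mono_def)
  then show "N f \<le> C"
    unfolding garling_norm_def by (intro cSUP_least) (use le in auto)
qed

lemma
  assumes "f \<in> X"
  shows N_nonneg: "0 \<le> N f" and wsum_le_N: "finite A \<Longrightarrow> wsum f A \<le> N f powr p"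
proof -
  have up: "(\<Sum>j. norm (f (\<phi> j)) powr p * w j) powr (1/p) \<le> N f" if "strict_mono \<phi>" for \<phi>
    unfolding garling_norm_def
    by (rule cSUP_upper) (use that assms in \<open>auto simp: garling_space_def\<close>)
  have "strict_mono (id :: nat \<Rightarrow> nat)" by (simp add: strict_mono_def)
  from up[OF this] show nn: "0 \<le> N f" using powr_ge_zero order_trans by blast
  assume fin: "finite A"
  \<comment> \<open>Prolong \<open>A\<close> to an infinite set; its increasing enumeration then meets \<open>A\<close> first.\<close>
  define S where "S = A \<union> {Suc (Max (insert 0 A))..}"
  have inf: "infinite S" unfolding S_def by (simp add: infinite_Ici)
  have A_less: "a < Suc (Max (insert 0 A))" if "a \<in> A" for a
    using that fin by (simp add: le_imp_less_Suc)
  have rk: "rank_in A a = rank_in S a" if "a \<in> A" for a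
  proof -
    have "S \<inter> {..<a} = A \<inter> {..<a}" using A_less[OF that] by (auto simp: S_def)
    then show ?thesis by (simp add: rank_in_def)
  qed
  have en: "enumerate S (rank_in A a) = a" if a: "a \<in> A" for a
  proof -
    have "a \<in> S" using a by (simp add: S_def)
    then obtain n where "enumerate S n = a" using enumerate_Ex[of S a] inf by blast
    then show ?thesis using rank_in_enumerate[OF inf, of n] rk[OF a] by simp
  qed
  have sm: "strict_mono (enumerate S)" by (simp add: strict_mono_enumerate inf)
  have su: "summable (\<lambda>j. norm (f (enumerate S j)) powr p * w j)"
    using assms sm by (auto simp: garling_space_def)
  have inj: "inj_on (rank_in A) A" by (metis en inj_onI)
  have "wsum f A = (\<Sum>j\<in>rank_in A ` A. norm (f (enumerate S j)) powr p * w j)"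
    by (simp add: wsum_def sum.reindex[OF inj] en)
  also have "\<dots> \<le> (\<Sum>j. norm (f (enumerate S j)) powr p * w j)"
    by (rule sum_le_suminf[OF su]) (use fin in \<open>auto simp: w_nonneg\<close>)
  also have "\<dots> = ((\<Sum>j. norm (f (enumerate S j)) powr p * w j) powr (1/p)) powr p"
    by (simp add: root_powr_p suminf_nonneg su w_nonneg)
  also have "\<dots> \<le> N f powr p" using up[OF sm] by (intro powr_p_mono) auto
  finally show "wsum f A \<le> N f powr p" .
qed

lemma norm_le_N: "f \<in> X \<Longrightarrow> norm (f k) \<le> N f"
  using wsum_le_N[of f "{k}"] N_nonneg[of f]
  by (simp add: wsum_def rank_in_def w0 powr_p_le_iff)

lemma garling_comparison:
  assumes "f \<in> X" and "\<And>k. norm (g k) \<le> norm (f k)"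
  shows "g \<in> X" and "N g \<le> N f"
proof -
  have "wsum g A \<le> N f powr p" if "finite A" for A
  proof -
    have "wsum g A \<le> wsum f A"
      unfolding wsum_def using assms(2)
      by (intro sum_mono mult_right_mono powr_p_mono) (auto simp: w_nonneg)
    then show ?thesis using wsum_le_N[OF assms(1) that] by simp
  qed
  then show "g \<in> X" "N g \<le> N f"
    using garling_boundI[of "N f" g] N_nonneg[OF assms(1)] by auto
qed

lemma
  assumes "f \<in> X"
  shows X_scale: "(\<lambda>k. c * f k) \<in> X" and N_scale_le: "N (\<lambda>k. c * f k) \<le> norm c * N f"
proof -
  have "wsum (\<lambda>k. c * f k) A \<le> (norm c * N f) powr p" if "finite A" for A
  proof -
    have "wsum (\<lambda>k. c * f k) A = norm c powr p * wsum f A"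
      by (simp add: wsum_def norm_mult powr_mult sum_distrib_left mult.assoc)
    also have "\<dots> \<le> norm c powr p * N f powr p"
      by (intro mult_left_mono wsum_le_N assms that) simp
    finally show ?thesis by (simp add: powr_mult N_nonneg[OF assms])
  qed
  then show "(\<lambda>k. c * f k) \<in> X" "N (\<lambda>k. c * f k) \<le> norm c * N f"
    using garling_boundI[of "norm c * N f" "\<lambda>k. c * f k"] N_nonneg[OF assms] by auto
qed

lemma powr_p_convex:
  assumes "0 \<le> x" "0 \<le> y" "0 < s" "0 < t" "s + t = 1"
  shows "(s * x + t * y) powr p \<le> s * x powr p + t * y powr p"
proof -
  have zero: "(r * z) powr p \<le> r * z powr p" if "0 < r" "r \<le> 1" "0 \<le> z" for r z
  proof -
    have "r powr p \<le> r powr 1" using that p by (intro powr_mono') auto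
    then show ?thesis using that by (simp add: powr_mult mult_right_mono)
  qed
  consider "x = 0" | "y = 0" | "0 < x" "0 < y" using assms by linarith
  then show ?thesis
  proof cases
    case 1
    then show ?thesis using zero[of t y] assms p by simp
  next
    case 2
    then show ?thesis using zero[of s x] assms p by simp
  next
    case 3
    have "1 - t = s" using assms by simp
    with convex_onD[OF powr_convex[OF p], of t x y] assms 3 show ?thesis by simp
  qed
qed

text \<open>
  Minkowski's inequality is the convexity of the \<open>p\<close>-th power applied to the convex combination
  with weights proportional to the two norms; the coordinate sums only add up convex combinations.
\<close>

lemma
  assumes f: "f \<in> X" and g: "g \<in> X"
  shows X_add: "(\<lambda>k. f k + g k) \<in> X" and N_triangle: "N (\<lambda>k. f k + g k) \<le> N f + N g"
proof -
  have bound: "wsum (\<lambda>k. f k + g k) A \<le> (\<alpha> + \<beta>) powr p"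
    if A: "finite A" and \<alpha>: "N f < \<alpha>" and \<beta>: "N g < \<beta>" for A \<alpha> \<beta>
  proof -
    have pos: "0 < \<alpha>" "0 < \<beta>" using \<alpha> \<beta> N_nonneg[OF f] N_nonneg[OF g] by auto
    define s t where "s = \<alpha> / (\<alpha> + \<beta>)" and "t = \<beta> / (\<alpha> + \<beta>)"
    have st: "0 < s" "0 < t" "s + t = 1"
      using pos by (auto simp: s_def t_def add_divide_distrib[symmetric])
    have pt: "norm (f k + g k) powr p
        \<le> (\<alpha> + \<beta>) powr p * (s * (norm (f k) powr p / \<alpha> powr p)
            + t * (norm (g k) powr p / \<beta> powr p))" for k
    proof -
      have "norm (f k + g k) powr p \<le> (norm (f k) + norm (g k)) powr p"
        by (intro powr_p_mono norm_triangle_ineq) simp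
      also have "norm (f k) + norm (g k)
          = (\<alpha> + \<beta>) * (s * (norm (f k) / \<alpha>) + t * (norm (g k) / \<beta>))"
      proof -
        have "(\<alpha> + \<beta>) * (s * (norm (f k) / \<alpha>) + t * (norm (g k) / \<beta>))
            = ((\<alpha> + \<beta>) * s / \<alpha>) * norm (f k) + ((\<alpha> + \<beta>) * t / \<beta>) * norm (g k)"
          by (simp add: algebra_simps)
        moreover have "(\<alpha> + \<beta>) * s / \<alpha> = 1" "(\<alpha> + \<beta>) * t / \<beta> = 1"
          using pos by (auto simp: s_def t_def)
        ultimately show ?thesis by simp
      qed
      also have "\<dots> powr p = (\<alpha> + \<beta>) powr p * (s * (norm (f k) / \<alpha>) + t * (norm (g k) / \<beta>)) powr p"
        by (rule powr_mult)
      also have "\<dots> \<le> (\<alpha> + \<beta>) powr p * (s * (norm (f k) / \<alpha>) powr p + t * (norm (g k) / \<beta>) powr p)"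
        using pos st by (intro mult_left_mono powr_p_convex) auto
      finally show ?thesis using pos by (simp add: powr_divide)
    qed
    have "wsum (\<lambda>k. f k + g k) A \<le> (\<Sum>a\<in>A. (\<alpha> + \<beta>) powr p * (s * (norm (f a) powr p / \<alpha> powr p)
            + t * (norm (g a) powr p / \<beta> powr p)) * w (rank_in A a))"
      unfolding wsum_def by (intro sum_mono mult_right_mono pt w_nonneg)
    also have "\<dots> = (\<alpha> + \<beta>) powr p * (s * (wsum f A / \<alpha> powr p) + t * (wsum g A / \<beta> powr p))"
      by (simp add: wsum_def sum.distrib sum_distrib_left sum_divide_distrib algebra_simps)
    also have "\<dots> \<le> (\<alpha> + \<beta>) powr p * (s * 1 + t * 1)"
    proof -
      have "wsum f A \<le> \<alpha> powr p"
        using wsum_le_N[OF f A] powr_p_mono[of "N f" \<alpha>] N_nonneg[OF f] \<alpha> by linarith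
      moreover have "wsum g A \<le> \<beta> powr p"
        using wsum_le_N[OF g A] powr_p_mono[of "N g" \<beta>] N_nonneg[OF g] \<beta> by linarith
      ultimately show ?thesis
        using pos st by (intro mult_left_mono add_mono) (auto simp: divide_le_eq)
    qed
    finally show ?thesis using st by simp
  qed
  have nn: "0 \<le> N f + N g" using N_nonneg[OF f] N_nonneg[OF g] by simp
  have *: "(\<lambda>k. f k + g k) \<in> X \<and> N (\<lambda>k. f k + g k) \<le> N f + N g + e" if "0 < e" for e
  proof -
    have "N f + e/2 + (N g + e/2) = N f + N g + e" by simp
    with bound[of _ "N f + e/2" "N g + e/2"] that
    have "wsum (\<lambda>k. f k + g k) A \<le> (N f + N g + e) powr p" if "finite A" for A
      using that by fastforce
    then show ?thesis
      using garling_boundI[of "N f + N g + e" "\<lambda>k. f k + g k"] that nn by auto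
  qed
  from this[of 1] show "(\<lambda>k. f k + g k) \<in> X" by simp
  from * show "N (\<lambda>k. f k + g k) \<le> N f + N g" using field_le_epsilon by blast
qed

lemma
  shows X_zero: "(\<lambda>_. 0 :: 'a :: real_normed_field) \<in> X"
    and N_zero: "N (\<lambda>_. 0 :: 'a) = 0"
proof -
  have "wsum (\<lambda>_. 0 :: 'a) A \<le> 0 powr p" for A using p by (simp add: wsum_def)
  from garling_boundI[OF order_refl this] N_nonneg[of "\<lambda>_. 0 :: 'a"]
  show "(\<lambda>_. 0 :: 'a) \<in> X" "N (\<lambda>_. 0 :: 'a) = 0" by auto
qed

lemma
  assumes f: "f \<in> X" and g: "g \<in> X"
  shows X_diff: "(\<lambda>k. f k - g k) \<in> X" and N_diff: "N (\<lambda>k. f k - g k) \<le> N f + N g"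
  using X_add[OF f X_scale[OF g, of "-1"]] N_triangle[OF f X_scale[OF g, of "-1"]]
    N_scale_le[OF g, of "-1"] by auto

lemma
  assumes "\<And>i. i \<in> I \<Longrightarrow> f i \<in> X"
  shows X_sum: "(\<lambda>k. \<Sum>i\<in>I. f i k) \<in> X" and N_sum: "N (\<lambda>k. \<Sum>i\<in>I. f i k) \<le> (\<Sum>i\<in>I. N (f i))"
proof -
  have "(\<lambda>k. \<Sum>i\<in>I. f i k) \<in> X \<and> N (\<lambda>k. \<Sum>i\<in>I. f i k) \<le> (\<Sum>i\<in>I. N (f i))"
    using assms
  proof (induction I rule: infinite_finite_induct)
    case (insert i I)
    then have "f i \<in> X" "(\<lambda>k. \<Sum>i\<in>I. f i k) \<in> X"
      "N (\<lambda>k. \<Sum>i\<in>I. f i k) \<le> (\<Sum>i\<in>I. N (f i))" by auto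
    with X_add[OF this(1,2)] N_triangle[OF this(1,2)] insert(1,2) show ?case by simp
  qed (auto simp: X_zero N_zero)
  then show "(\<lambda>k. \<Sum>i\<in>I. f i k) \<in> X" "N (\<lambda>k. \<Sum>i\<in>I. f i k) \<le> (\<Sum>i\<in>I. N (f i))" by auto
qed

text \<open>
  Reading \<open>f\<close> along an increasing map is a contraction: a finite set of coordinates is carried to
  another one of the same order type, and dropping elements only lowers the ranks.
\<close>

lemma
  assumes f: "f \<in> X" and \<psi>: "strict_mono_on S \<psi>"
  shows X_spread: "(\<lambda>k. if k \<in> S then f (\<psi> k) else 0) \<in> X"
    and N_spread: "N (\<lambda>k. if k \<in> S then f (\<psi> k) else 0) \<le> N f"
proof -
  let ?g = "\<lambda>k. if k \<in> S then f (\<psi> k) else 0"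
  have "wsum ?g A \<le> N f powr p" if A: "finite A" for A
  proof -
    have inj: "inj_on \<psi> (A \<inter> S)" using \<psi> by (meson inf.cobounded2 inj_on_subset strict_mono_on_imp_inj_on)
    have "wsum ?g A = (\<Sum>a\<in>A \<inter> S. norm (?g a) powr p * w (rank_in A a))"
      unfolding wsum_def by (rule sum.mono_neutral_right) (use A p in auto)
    also have "\<dots> \<le> (\<Sum>a\<in>A \<inter> S. norm (f (\<psi> a)) powr p * w (rank_in (A \<inter> S) a))"
      by (rule sum_mono) (auto intro!: mult_left_mono w_mono rank_in_subset)
    also have "\<dots> = wsum f (\<psi> ` (A \<inter> S))"
      using rank_in_image[OF \<psi>, of "A \<inter> S"] by (simp add: wsum_def sum.reindex[OF inj])
    also have "\<dots> \<le> N f powr p" by (rule wsum_le_N[OF f]) (use A in simp)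
    finally show ?thesis .
  qed
  then show "?g \<in> X" "N ?g \<le> N f"
    using garling_boundI[of "N f" ?g] N_nonneg[OF f] by auto
qed

lemma X_finite_support:
  fixes f :: "nat \<Rightarrow> 'a::real_normed_field"
  assumes "\<And>k. n \<le> k \<Longrightarrow> f k = 0"
  shows "f \<in> X"
proof -
  define C where "C = (\<Sum>k<n. norm (f k) powr p)"
  have C: "0 \<le> C" by (simp add: C_def sum_nonneg)
  have "wsum f A \<le> (C powr (1/p)) powr p" if A: "finite A" for A
  proof -
    have "wsum f A \<le> (\<Sum>a\<in>A. norm (f a) powr p)"
      unfolding wsum_def using w_mono[of 0] w0 by (intro sum_mono mult_right_le_one_le) (auto simp: w_nonneg)
    also have "\<dots> = (\<Sum>a\<in>A \<inter> {..<n}. norm (f a) powr p)"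
      using assms A p by (intro sum.mono_neutral_right) (auto simp: not_less)
    also have "\<dots> \<le> C" unfolding C_def by (intro sum_mono2) auto
    finally show ?thesis by (simp add: root_powr_p C)
  qed
  from garling_boundI(1)[OF powr_ge_zero this] show ?thesis .
qed

definition tail :: "nat \<Rightarrow> (nat \<Rightarrow> 'a::real_normed_field) \<Rightarrow> nat \<Rightarrow> 'a" where
  "tail n f = (\<lambda>k. if n \<le> k then f k else 0)"

lemma tail_X: "f \<in> X \<Longrightarrow> tail n f \<in> X"
  using garling_comparison(1)[of f "tail n f"] by (auto simp: tail_def)

lemma N_tail_mono:
  "f \<in> X \<Longrightarrow> m \<le> n \<Longrightarrow> N (tail n f) \<le> N (tail m f)"
  by (rule garling_comparison(2)[OF tail_X]) (auto simp: tail_def)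

lemma garling_null_sequence:
  assumes f: "f \<in> X"
  shows "f \<longlonglongrightarrow> 0"
proof (rule ccontr)
  assume "\<not> f \<longlonglongrightarrow> 0"
  then obtain e where e: "0 < e" and inf: "\<forall>n0. \<exists>n\<ge>n0. e \<le> norm (f n)"
    unfolding LIMSEQ_iff by (auto simp: not_less)
  define S where "S = {n. e \<le> norm (f n)}"
  have S: "infinite S" using inf unfolding infinite_nat_iff_unbounded_le S_def by auto
  have sm: "strict_mono (enumerate S)" by (simp add: strict_mono_enumerate S)
  then have su: "summable (\<lambda>j. norm (f (enumerate S j)) powr p * w j)"
    using f by (auto simp: garling_space_def)
  have "summable (\<lambda>j. e powr p * w j)"
  proof (rule summable_comparison_test[OF _ su], intro exI allI impI)
    fix j
    have "e \<le> norm (f (enumerate S j))" using enumerate_in_set[OF S, of j] by (simp add: S_def)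
    then show "norm (e powr p * w j) \<le> norm (f (enumerate S j)) powr p * w j"
      using e by (auto simp: w_nonneg abs_mult intro!: mult_right_mono powr_p_mono)
  qed
  then have "summable w" using e by (subst (asm) summable_cmult_iff) auto
  with w_not_summable show False ..
qed

text \<open>
  If the tails did not tend to zero, finite sets with a fixed amount of mass would exist
  arbitrarily far out. Removing from such a set as many of its first elements as the sets chosen
  before have in total costs little, because \<open>f\<close> is a null sequence; and after this removal the
  set can be appended to the earlier ones without lowering any weight. The masses then add up
  beyond every bound.
\<close>

lemma N_tail_tendsto:
  assumes f: "f \<in> X"
  shows "(\<lambda>n. N (tail n f)) \<longlonglongrightarrow> 0"
proof (rule ccontr)
  assume "\<not> (\<lambda>n. N (tail n f)) \<longlonglongrightarrow> 0"
  then obtain e where e: "0 < e" and inf: "\<forall>n0. \<exists>n\<ge>n0. e \<le> N (tail n f)"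
    unfolding LIMSEQ_iff using N_nonneg[OF tail_X[OF f]] by (auto simp: not_less)
  have big: "e \<le> N (tail n f)" for n
    using inf N_tail_mono[OF f] order_trans by blast
  define d where "d = (e/2) powr p"
  have d: "0 < d" using e by (simp add: d_def)
  have far: "\<exists>A. finite A \<and> A \<subseteq> {n..} \<and> d < wsum f A" for n
  proof -
    have "\<not> (\<forall>A. finite A \<longrightarrow> wsum (tail n f) A \<le> d)"
      using garling_boundI(2)[of "e/2" "tail n f"] big[of n] e by (auto simp: d_def)
    then obtain A where A: "finite A" "d < wsum (tail n f) A" by (auto simp: not_le)
    have "wsum (tail n f) A = (\<Sum>a\<in>A \<inter> {n..}. norm (f a) powr p * w (rank_in A a))"
      unfolding wsum_def using A p by (intro sum.mono_neutral_cong_right) (auto simp: tail_def)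
    also have "\<dots> \<le> wsum f (A \<inter> {n..})"
      unfolding wsum_def by (intro sum_mono mult_left_mono w_mono rank_in_subset) auto
    finally show ?thesis using A by (intro exI[of _ "A \<inter> {n..}"]) auto
  qed
  have step: "\<exists>A'. finite A' \<and> wsum f A + d/2 \<le> wsum f A'" if A: "finite A" for A
  proof -
    define c where "c = card A"
    have "(\<lambda>k. norm (f k) powr p) \<longlonglongrightarrow> 0 powr p"
      using p garling_null_sequence[OF f] by (intro tendsto_powr' tendsto_norm_zero) auto
    then have "\<forall>\<^sub>F k in sequentially. norm (f k) powr p < d / (2 * (c + 1))"
      using d p by (intro order_tendstoD) auto
    then obtain n0 where n0: "\<And>k. n0 \<le> k \<Longrightarrow> norm (f k) powr p < d / (2 * (c + 1))"
      by (auto simp: eventually_sequentially)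
    \<comment> \<open>Beyond \<open>n0\<close>, any \<open>c\<close> coordinates together weigh at most half of the mass \<open>d\<close>.\<close>
    obtain n1 where n1: "\<And>a. a \<in> A \<Longrightarrow> a < n1" using A finite_nat_iff_bounded by (meson lessThan_iff subsetD)
    obtain F where F: "finite F" "F \<subseteq> {max n0 n1..}" "d < wsum f F" using far by blast
    define F1 where "F1 = {a \<in> F. rank_in F a < c}"
    define F2 where "F2 = {a \<in> F. c \<le> rank_in F a}"
    have disj: "A \<inter> F2 = {}" using n1 F(2) by (fastforce simp: F2_def)
    have rA: "rank_in (A \<union> F2) a = rank_in A a" if "a \<in> A" for a
    proof -
      have "(A \<union> F2) \<inter> {..<a} = A \<inter> {..<a}" using n1[OF that] F(2) by (fastforce simp: F2_def)
      then show ?thesis by (simp add: rank_in_def)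
    qed
    have cF1: "card F1 \<le> c"
    proof -
      have "card F1 = card (rank_in F ` F1)"
        by (intro card_image[symmetric] inj_on_subset[OF inj_on_rank_in[OF F(1)]]) (auto simp: F1_def)
      also have "\<dots> \<le> card {..<c}" by (intro card_mono) (auto simp: F1_def)
      finally show ?thesis by simp
    qed
    have rF: "rank_in (A \<union> F2) a \<le> rank_in F a" if "a \<in> F2" for a
      using rank_in_append[OF A F(1) _ that] by (simp add: F2_def c_def)
    have "wsum f (A \<union> F2) = (\<Sum>a\<in>A. norm (f a) powr p * w (rank_in (A \<union> F2) a))
        + (\<Sum>a\<in>F2. norm (f a) powr p * w (rank_in (A \<union> F2) a))"
      unfolding wsum_def using A F(1) disj by (intro sum.union_disjoint) (auto simp: F2_def)
    also have "(\<Sum>a\<in>A. norm (f a) powr p * w (rank_in (A \<union> F2) a)) = wsum f A"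
      by (simp add: wsum_def rA)
    finally have 1: "wsum f (A \<union> F2) = wsum f A
        + (\<Sum>a\<in>F2. norm (f a) powr p * w (rank_in (A \<union> F2) a))" .
    have "(\<Sum>a\<in>F2. norm (f a) powr p * w (rank_in (A \<union> F2) a))
        \<ge> (\<Sum>a\<in>F2. norm (f a) powr p * w (rank_in F a))"
      by (intro sum_mono mult_left_mono w_mono rF) auto
    moreover have "wsum f F = (\<Sum>a\<in>F1. norm (f a) powr p * w (rank_in F a))
        + (\<Sum>a\<in>F2. norm (f a) powr p * w (rank_in F a))"
    proof -
      have "F = F1 \<union> F2" "F1 \<inter> F2 = {}" "finite F1" "finite F2"
        using F(1) by (auto simp: F1_def F2_def)
      then show ?thesis unfolding wsum_def using sum.union_disjoint[of F1 F2] by simp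
    qed
    moreover have "(\<Sum>a\<in>F1. norm (f a) powr p * w (rank_in F a)) \<le> d/2"
    proof -
      have "(\<Sum>a\<in>F1. norm (f a) powr p * w (rank_in F a)) \<le> (\<Sum>a\<in>F1. d / (2 * (c + 1)))"
      proof (rule sum_mono)
        fix a assume "a \<in> F1"
        then have "norm (f a) powr p \<le> d / (2 * (c + 1))"
          using n0[of a] F(2) by (force simp: F1_def)
        moreover have "norm (f a) powr p * w (rank_in F a) \<le> norm (f a) powr p"
          using w_mono[of 0] w0 by (intro mult_left_le) auto
        ultimately show "norm (f a) powr p * w (rank_in F a) \<le> d / (2 * (c + 1))" by linarith
      qed
      also have "\<dots> = card F1 * (d / (2 * (c + 1)))" by simp
      also have "\<dots> \<le> (c + 1) * (d / (2 * (c + 1)))"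
        using cF1 d by (intro mult_right_mono) auto
      also have "\<dots> = d/2" by (simp add: field_simps)
      finally show ?thesis .
    qed
    ultimately have "wsum f A + d/2 \<le> wsum f (A \<union> F2)" using 1 F(3) by linarith
    moreover have "finite (A \<union> F2)" using A F(1) by (simp add: F2_def)
    ultimately show ?thesis by (intro exI[of _ "A \<union> F2"] conjI)
  qed
  have "\<exists>A. finite A \<and> real n * (d/2) \<le> wsum f A" for n
  proof (induction n)
    case 0
    show ?case using wsum_nonneg by (intro exI[of _ "{}"]) auto
  next
    case (Suc n)
    then obtain A where "finite A" "real n * (d/2) \<le> wsum f A" by blast
    with step[of A] show ?case by (force simp: algebra_simps)
  qed
  moreover obtain n where "N f powr p < real n * (d/2)"
    using reals_Archimedean3[of "d/2"] d by auto
  ultimately obtain A where "finite A" "N f powr p < wsum f A" by (meson less_le_trans)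
  with wsum_le_N[OF f, of A] show False by simp
qed

end

section \<open>Averaging over a partition into intervals\<close>

lemma sum_mod_period:
  fixes h :: "nat \<Rightarrow> 'a::comm_monoid_add"
  shows "(\<Sum>r\<in>{c..<c + M}. h (r mod M)) = (\<Sum>j<M. h j)"
proof (induction c)
  case 0
  show ?case by (simp add: atLeast0LessThan)
next
  case (Suc c)
  have "(\<Sum>r\<in>{Suc c..<Suc c + M}. h (r mod M)) = (\<Sum>r\<in>{c..<c + M}. h (r mod M))"
  proof (cases "M = 0")
    case False
    then have "{Suc c..<Suc c + M} = insert (c + M) {Suc c..<c + M}"
      and "{c..<c + M} = insert c {Suc c..<c + M}" by auto
    then show ?thesis by simp
  qed simp
  then show ?case using Suc by simp
qed

lemma sum_mod_multiple:
  fixes h :: "nat \<Rightarrow> 'a::comm_semiring_1"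
  shows "(\<Sum>r<K * M. h ((c + r) mod M)) = of_nat K * (\<Sum>j<M. h j)"
proof (induction K)
  case (Suc K)
  have "{..<Suc K * M} = {..<K * M} \<union> {K * M..<K * M + M}" by auto
  then have "(\<Sum>r<Suc K * M. h ((c + r) mod M))
      = (\<Sum>r<K * M. h ((c + r) mod M)) + (\<Sum>r\<in>{K * M..<K * M + M}. h ((c + r) mod M))"
    by (simp add: sum.union_disjoint ivl_disj_int)
  also have "(\<Sum>r\<in>{K * M..<K * M + M}. h ((c + r) mod M))
      = (\<Sum>r\<in>{c + K * M..<c + K * M + M}. h (r mod M))"
    by (rule sum.reindex_bij_witness[of _ "\<lambda>r. r - c" "\<lambda>r. c + r"]) auto
  also have "\<dots> = (\<Sum>j<M. h j)" by (rule sum_mod_period)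
  finally show ?case using Suc by (simp add: algebra_simps)
qed simp

definition avg :: "nat \<Rightarrow> nat \<Rightarrow> (nat \<Rightarrow> 'a::real_normed_field) \<Rightarrow> 'a" where
  "avg a b f = (\<Sum>j\<in>{a..<b}. f j) / of_nat (b - a)"

lemma avg_add: "avg a b (\<lambda>k. f k + g k) = avg a b f + avg a b g"
  by (simp add: avg_def sum.distrib add_divide_distrib)

lemma avg_scale: "avg a b (\<lambda>k. c * f k) = c * avg a b f"
  by (simp add: avg_def sum_distrib_left)

lemma avg_const:
  assumes "\<And>j. a \<le> j \<Longrightarrow> j < b \<Longrightarrow> f j = c" and "a < b"
  shows "avg a b f = c"
  using assms by (simp add: avg_def)

lemma avg_zero:
  "(\<And>j. a \<le> j \<Longrightarrow> j < b \<Longrightarrow> f j = 0) \<Longrightarrow> avg a b f = 0"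
  by (simp add: avg_def)

text \<open>
  A partition of the index set into intervals is given by the functions sending an index to the
  two ends of the interval it lies in.
\<close>

locale interval_partition =
  fixes lo hi :: "nat \<Rightarrow> nat"
  assumes lo_le: "lo i \<le> i" and less_hi: "i < hi i"
    and same_interval: "lo i \<le> j \<Longrightarrow> j < hi i \<Longrightarrow> lo j = lo i \<and> hi j = hi i"
begin

lemma hi_le_lo:
  assumes "i < j" and "lo j \<noteq> lo i"
  shows "hi i \<le> lo j"
proof (rule ccontr)
  assume c: "\<not> hi i \<le> lo j"
  have "hi i \<le> j"
    using same_interval[of i j] assms lo_le[of i] by (meson le_trans less_imp_le not_le)
  define m where "m = hi i - 1"
  have m: "lo j \<le> m" "m < j" "lo i \<le> m" "m < hi i"
    using c \<open>hi i \<le> j\<close> lo_le[of i] less_hi[of i] by (auto simp: m_def)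
  then have "lo m = lo j" "lo m = lo i"
    using same_interval[of j m] same_interval[of i m] less_hi[of j] by auto
  with assms show False by simp
qed

text \<open>
  All intervals are rotated cyclically at once. The rotation is increasing on \<open>unwrapped r\<close>, the
  set of the points that are not carried past the end of their interval, and on its complement.
\<close>

definition rotate_by :: "nat \<Rightarrow> nat \<Rightarrow> nat" where
  "rotate_by r i = lo i + (i - lo i + r) mod (hi i - lo i)"

definition unwrapped :: "nat \<Rightarrow> nat set" where
  "unwrapped r = {i. i - lo i + r mod (hi i - lo i) < hi i - lo i}"

lemma rotate_by_bounds: "lo i \<le> rotate_by r i" "rotate_by r i < hi i"
proof -
  have "lo i < hi i" using lo_le less_hi by (rule le_less_trans)
  moreover from this have "(i - lo i + r) mod (hi i - lo i) < hi i - lo i" by simp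
  ultimately show "lo i \<le> rotate_by r i" "rotate_by r i < hi i"
    unfolding rotate_by_def by linarith+
qed

text \<open>On each of the two pieces the rotation is a translation within every interval.\<close>

lemma rotate_by_eq:
  "rotate_by r i = (if i \<in> unwrapped r then i + r mod (hi i - lo i)
     else i + r mod (hi i - lo i) - (hi i - lo i))"
proof -
  define M where "M = hi i - lo i"
  have M: "i - lo i < M" using lo_le[of i] less_hi[of i] by (auto simp: M_def)
  then have r: "r mod M < M" by simp
  have "(i - lo i + r) mod M = (i - lo i + r mod M) mod M" by presburger
  also have "\<dots> = (if i - lo i + r mod M < M then i - lo i + r mod M else i - lo i + r mod M - M)"
  proof (cases "i - lo i + r mod M < M")
    case False
    then have "i - lo i + r mod M - M < M" using M r by linarith
    with False show ?thesis by (simp add: le_mod_geq)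
  qed simp
  finally have "rotate_by r i = lo i + (if i - lo i + r mod M < M then i - lo i + r mod M
      else i - lo i + r mod M - M)"
    by (simp add: rotate_by_def M_def)
  moreover have "lo i + (i - lo i + r mod M) = i + r mod M" using lo_le[of i] by simp
  moreover have "lo i + (i - lo i + r mod M - M) = i + r mod M - M" if "\<not> i - lo i + r mod M < M"
    using that lo_le[of i] by linarith
  moreover have "i \<in> unwrapped r \<longleftrightarrow> i - lo i + r mod M < M" by (simp add: unwrapped_def M_def)
  ultimately show ?thesis unfolding M_def[symmetric] by simp
qed

lemma rotate_by_strict_mono:
  assumes "S = unwrapped r \<or> S = - unwrapped r"
  shows "strict_mono_on S (rotate_by r)"
proof (rule strict_mono_onI)
  fix i j assume S: "i \<in> S" "j \<in> S" and "i < j"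
  show "rotate_by r i < rotate_by r j"
  proof (cases "lo j = lo i")
    case True
    then have h: "hi j = hi i"
      using same_interval[of j i] lo_le[of i] less_hi[of j] \<open>i < j\<close> by simp
    define x M where "x = r mod (hi i - lo i)" and "M = hi i - lo i"
    have iff: "k \<in> unwrapped r \<longleftrightarrow> k - lo i + x < M" if "k \<in> {i, j}" for k
      using that h True by (auto simp: unwrapped_def x_def M_def)
    have eqs: "rotate_by r k = (if k \<in> unwrapped r then k + x else k + x - M)" if "k \<in> {i, j}" for k
      using rotate_by_eq[of r k] that h True by (auto simp: x_def M_def)
    from S assms have "(i - lo i + x < M \<and> j - lo i + x < M) \<or> (M \<le> i - lo i + x \<and> M \<le> j - lo i + x)"
      using iff by (auto simp: not_less)
    then show ?thesis
    proof
      assume "i - lo i + x < M \<and> j - lo i + x < M"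
      then show ?thesis using \<open>i < j\<close> by (simp add: eqs iff)
    next
      assume "M \<le> i - lo i + x \<and> M \<le> j - lo i + x"
      moreover from this have "i + x - M < j + x - M" using \<open>i < j\<close> by linarith
      ultimately show ?thesis by (simp add: eqs iff)
    qed
  next
    case False
    then show ?thesis
      using hi_le_lo[OF \<open>i < j\<close>] rotate_by_bounds(2)[of r i] rotate_by_bounds(1)[of j r] by linarith
  qed
qed

definition averaging :: "(nat \<Rightarrow> 'a::real_normed_field) \<Rightarrow> nat \<Rightarrow> 'a" where
  "averaging f i = avg (lo i) (hi i) f"

text \<open>
  If \<open>R\<close> is a multiple of the length of an interval, then \<open>R\<close> successive rotations visit every
  point of that interval equally often. A common multiple serves finitely many intervals at once.
\<close>

lemma averaging_eq_mean_of_rotations: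
  fixes f :: "nat \<Rightarrow> 'a::real_normed_field"
  assumes "hi i - lo i dvd R" "0 < R"
  shows "averaging f i = inverse (of_nat R) * (\<Sum>r<R. f (rotate_by r i))"
proof -
  define M where "M = hi i - lo i"
  have M: "0 < M" using lo_le[of i] less_hi[of i] by (auto simp: M_def)
  obtain K where K: "R = K * M" using assms(1) by (metis M_def dvd_def mult.commute)
  have "(\<Sum>r<R. f (rotate_by r i)) = of_nat K * (\<Sum>j<M. f (lo i + j))"
    using sum_mod_multiple[of "\<lambda>j. f (lo i + j)" "i - lo i" M K]
    by (simp add: K rotate_by_def M_def)
  also have "(\<Sum>j<M. f (lo i + j)) = (\<Sum>j\<in>{lo i..<hi i}. f j)"
    using M by (intro sum.reindex_bij_witness[of _ "\<lambda>j. j - lo i" "\<lambda>j. lo i + j"])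
      (auto simp: M_def)
  finally show ?thesis
    using K assms(2) M by (auto simp: averaging_def avg_def M_def[symmetric] field_simps)
qed

end

context garling_weight
begin

text \<open>
  On any finite set of coordinates the averaging operator is a mean of simultaneous cyclic
  rotations of all the intervals. A rotation is increasing apart from the wrap-around, so it
  splits into two pieces that read \<open>f\<close> along increasing maps.
\<close>

lemma
  assumes "interval_partition lo hi" and f: "f \<in> X"
  shows X_averaging: "interval_partition.averaging lo hi f \<in> X"
    and N_averaging: "N (interval_partition.averaging lo hi f) \<le> 2 * N f"
proof -
  interpret interval_partition lo hi by fact
  have rot: "(\<lambda>i. f (rotate_by r i)) \<in> X" "N (\<lambda>i. f (rotate_by r i)) \<le> 2 * N f" for r
  proof -
    let ?f = "\<lambda>S k. if k \<in> S then f (rotate_by r k) else 0"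
    let ?S = "unwrapped r"
    have m: "strict_mono_on ?S (rotate_by r)" "strict_mono_on (- ?S) (rotate_by r)"
      by (auto intro: rotate_by_strict_mono)
    have "(\<lambda>i. f (rotate_by r i)) = (\<lambda>k. ?f ?S k + ?f (- ?S) k)" by auto
    then show "(\<lambda>i. f (rotate_by r i)) \<in> X" "N (\<lambda>i. f (rotate_by r i)) \<le> 2 * N f"
      using X_add[OF X_spread[OF f m(1)] X_spread[OF f m(2)]]
        N_triangle[OF X_spread[OF f m(1)] X_spread[OF f m(2)]]
        N_spread[OF f m(1)] N_spread[OF f m(2)] by auto
  qed
  have "wsum (averaging f) A \<le> (2 * N f) powr p" if A: "finite A" for A
  proof -
    define R where "R = (\<Prod>i\<in>A. hi i - lo i)"
    define g where "g = (\<lambda>i. inverse (of_nat R) * (\<Sum>r<R. f (rotate_by r i)))"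
    have R: "0 < R" unfolding R_def
      by (rule prod_pos) (simp add: le_less_trans[OF lo_le less_hi])
    have s: "(\<lambda>i. \<Sum>r<R. f (rotate_by r i)) \<in> X" by (rule X_sum) (rule rot)
    have g: "g \<in> X" unfolding g_def by (rule X_scale[OF s])
    have "N g \<le> inverse (real R) * N (\<lambda>i. \<Sum>r<R. f (rotate_by r i))"
      using N_scale_le[OF s, of "inverse (of_nat R)"] by (simp add: g_def norm_inverse)
    also have "\<dots> \<le> inverse (real R) * (\<Sum>r<R. N (\<lambda>i. f (rotate_by r i)))"
      by (intro mult_left_mono N_sum rot) simp
    also have "\<dots> \<le> inverse (real R) * (\<Sum>r<R. 2 * N f)"
      by (intro mult_left_mono sum_mono rot) simp
    also have "\<dots> = 2 * N f" using R by simp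
    finally have Ng: "N g \<le> 2 * N f" .
    have "averaging f a = g a" if "a \<in> A" for a
      unfolding g_def by (rule averaging_eq_mean_of_rotations[OF _ R]) (use A that in \<open>auto simp: R_def\<close>)
    then have "wsum (averaging f) A = wsum g A" by (intro wsum_cong) simp
    also have "\<dots> \<le> N g powr p" by (rule wsum_le_N[OF g A])
    also have "\<dots> \<le> (2 * N f) powr p" by (intro powr_p_mono Ng N_nonneg g)
    finally show ?thesis .
  qed
  then show "averaging f \<in> X" "N (averaging f) \<le> 2 * N f"
    using garling_boundI[of "2 * N f" "averaging f"] N_nonneg[OF f] by auto
qed

end

section \<open>Block vectors spanning copies of finite-dimensional sup-norm spaces\<close>

lemma half_powers_sum_le: "(\<Sum>k\<in>{a..<b}. (1/2::real) ^ (b - Suc k)) \<le> 2"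
proof -
  have "(\<Sum>k\<in>{a..<b}. (1/2::real) ^ (b - Suc k)) = (\<Sum>r<b - a. (1/2) ^ r)"
    by (rule sum.reindex_bij_witness[of _ "\<lambda>r. b - Suc r" "\<lambda>k. b - Suc k"]) auto
  also have "\<dots> = 2 - 2 * (1/2) ^ (b - a)"
    by (subst sum_gp_strict) (simp add: field_simps)
  also have "\<dots> \<le> 2" by simp
  finally show ?thesis .
qed

text \<open>
  The numbers of the intervals are cut into groups: group \<open>n\<close> is \<open>{2 ^ n - 1..<2 ^ Suc n - 1}\<close>,
  with \<open>2 ^ n\<close> members.
\<close>

definition group_of :: "nat \<Rightarrow> nat" where
  "group_of k = floor_log (Suc k)"

definition group_end :: "nat \<Rightarrow> nat" where
  "group_end k = 2 ^ Suc (group_of k) - 1"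

lemma group_of_eq_iff:
  "group_of k = n \<longleftrightarrow> 2 ^ n - 1 \<le> k \<and> k < 2 ^ Suc n - 1"
proof -
  have "2 ^ group_of k \<le> Suc k" "Suc k < 2 ^ Suc (group_of k)"
    using floor_log_exp2_le[of "Suc k"] floor_log_exp2_gt[of "Suc k"] by (auto simp: group_of_def)
  then have b: "2 ^ group_of k - 1 \<le> k" "k < 2 ^ Suc (group_of k) - 1" by linarith+
  moreover have "group_of k = n" if "2 ^ n - 1 \<le> k \<and> k < 2 ^ Suc n - 1"
    unfolding group_of_def by (rule floor_log_eqI) (use that in auto)
  ultimately show ?thesis by auto
qed

lemma group_end_eq:
  "2 ^ n - 1 \<le> k \<Longrightarrow> k < 2 ^ Suc n - 1 \<Longrightarrow> group_end k = 2 ^ Suc n - 1"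
  by (metis group_end_def group_of_eq_iff)

lemma less_group_end: "k < group_end k"
  using group_of_eq_iff[of k "group_of k"] by (simp add: group_end_def)

lemma same_group:
  "k \<le> l \<Longrightarrow> l < group_end k \<Longrightarrow> group_end l = group_end k"
proof -
  assume "k \<le> l" "l < group_end k"
  then have "2 ^ group_of k - 1 \<le> l" "l < 2 ^ Suc (group_of k) - 1"
    using group_of_eq_iff[of k "group_of k"] by (auto simp: group_end_def)
  then have "group_of l = group_of k" by (simp only: group_of_eq_iff simp_thms)
  then show "group_end l = group_end k" by (simp add: group_end_def)
qed

context garling_weight
begin

definition weight_sum :: "nat \<Rightarrow> real" where
  "weight_sum n = (\<Sum>i<n. w i)"

lemma weight_sum_mono: "m \<le> n \<Longrightarrow> weight_sum m \<le> weight_sum n"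
  unfolding weight_sum_def by (rule sum_mono2) (auto simp: w_nonneg)

lemma weight_sum_ge_1: "1 \<le> n \<Longrightarrow> 1 \<le> weight_sum n"
  using weight_sum_mono[of 1 n] by (simp add: weight_sum_def w0)

lemma weight_sum_nonneg: "0 \<le> weight_sum n"
  unfolding weight_sum_def by (simp add: sum_nonneg w_nonneg)

lemma weight_sum_unbounded: "\<exists>n>m. C \<le> weight_sum n"
proof (rule ccontr)
  assume "\<not> (\<exists>n>m. C \<le> weight_sum n)"
  then have c: "weight_sum n < C" if "m < n" for n using that by force
  have "weight_sum n \<le> C" for n using c[of "Suc (max m n)"] weight_sum_mono[of n "Suc (max m n)"] by fastforce
  then have "summable w"
    by (intro summableI_nonneg_bounded[of w C]) (auto simp: w_nonneg weight_sum_def)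
  with w_not_summable show False ..
qed

text \<open>
  The lengths \<open>q r\<close> are separated by scales \<open>t r\<close>: beyond position \<open>t s\<close> the weights are too small
  for an interval of length \<open>q r\<close> with \<open>r < s\<close> to count, and a subset of at most \<open>t r\<close> elements of
  an interval of length \<open>q r\<close> does not count either.
\<close>

lemma separated_lengths_exist:
  "\<exists>q t :: nat \<Rightarrow> nat. (\<forall>r. 2 \<le> q r) \<and> (\<forall>r s. r < s \<longrightarrow> q r * w (t s) \<le> (1/2) ^ r)
     \<and> (\<forall>r. weight_sum (t r) \<le> (1/2) ^ r * weight_sum (q r))"
proof -
  let ?P = "\<lambda>r (z :: nat \<times> nat). 2 \<le> snd z \<and> weight_sum (fst z) \<le> (1/2) ^ r * weight_sum (snd z)"
  let ?Q = "\<lambda>r (z :: nat \<times> nat) (z' :: nat \<times> nat).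
    snd z < snd z' \<and> real (snd z) * w (fst z') \<le> (1/2) ^ r"
  have "?P 0 (0, 2)" using weight_sum_nonneg[of 2] by (simp add: weight_sum_def)
  then have base: "\<exists>z. ?P 0 z" by blast
  have step: "\<exists>z'. ?P (Suc r) z' \<and> ?Q r z z'" if "?P r z" for z r
  proof -
    have "(\<lambda>n. real (snd z) * w n) \<longlonglongrightarrow> real (snd z) * 0" by (intro tendsto_mult tendsto_const w_lim)
    then have "\<forall>\<^sub>F n in sequentially. real (snd z) * w n < (1/2) ^ r"
      by (intro order_tendstoD) auto
    then obtain t' where t': "real (snd z) * w t' < (1/2) ^ r"
      using eventually_happens trivial_limit_sequentially by blast
    obtain q' where q': "snd z < q'" "2 ^ Suc r * weight_sum t' \<le> weight_sum q'" using weight_sum_unbounded by blast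
    then have "weight_sum t' \<le> (1/2) ^ Suc r * weight_sum q'" by (simp add: field_simps power_divide)
    then show ?thesis using t' q' that by (intro exI[of _ "(t', q')"]) auto
  qed
  obtain z where z: "\<And>r. ?P r (z r)" "\<And>r. ?Q r (z r) (z (Suc r))"
    using dependent_nat_choice[of ?P ?Q, OF base step] by blast
  have mono: "snd (z r) \<le> snd (z s)" if "r \<le> s" for r s
    using z(2) that lift_Suc_mono_le[of "\<lambda>r. snd (z r)" r s] less_imp_le by blast
  have "real (snd (z r)) * w (fst (z s)) \<le> (1/2) ^ r" if rs: "r < s" for r s
  proof -
    obtain s' where s': "s = Suc s'" "r \<le> s'" using rs by (cases s) auto
    have "real (snd (z r)) * w (fst (z s)) \<le> real (snd (z s')) * w (fst (z s))"
      using mono[OF s'(2)] by (intro mult_right_mono w_nonneg) simp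
    also have "\<dots> \<le> (1/2) ^ s'" using z(2)[of s'] s' by simp
    also have "\<dots> \<le> (1/2) ^ r" using s' by (intro power_decreasing) auto
    finally show ?thesis .
  qed
  then show ?thesis using z(1) by (intro exI[of _ "snd \<circ> z"] exI[of _ "fst \<circ> z"]) auto
qed

end

locale garling_blocks = garling_weight +
  fixes q t :: "nat \<Rightarrow> nat"
  assumes q_ge_2: "2 \<le> q r"
    and late_small: "r < s \<Longrightarrow> q r * w (t s) \<le> (1/2) ^ r"
    and few_small: "weight_sum (t r) \<le> (1/2) ^ r * weight_sum (q r)"
begin

text \<open>
  Within a group the intervals get shorter from left to right. This orientation makes the sum of
  the normalized indicators small: whoever picks much of one interval has used up the large
  weights before reaching the shorter and hence higher ones.
\<close>

definition len :: "nat \<Rightarrow> nat" where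
  "len k = q (group_end k - Suc k)"

definition start :: "nat \<Rightarrow> nat" where
  "start k = (\<Sum>i<k. len i)"

lemma len_ge_2: "2 \<le> len k"
  by (simp add: len_def q_ge_2)

lemma start_Suc: "start (Suc k) = start k + len k"
  by (simp add: start_def)

lemma strict_mono_start: "strict_mono start"
  unfolding strict_mono_Suc_iff using less_le_trans[OF _ len_ge_2, of 0] by (simp add: start_Suc)

lemma start_le_iff: "start a \<le> start b \<longleftrightarrow> a \<le> b"
  by (rule strict_mono_less_eq[OF strict_mono_start])

lemma le_start: "k \<le> start k"
  using strict_mono_start by (rule strict_mono_imp_increasing)

definition block_of :: "nat \<Rightarrow> nat" where
  "block_of i = (LEAST k. i < start (Suc k))"

definition lo :: "nat \<Rightarrow> nat" where
  "lo i = start (block_of i)"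

definition hi :: "nat \<Rightarrow> nat" where
  "hi i = start (Suc (block_of i))"

lemma less_hi_block_of: "i < hi i"
proof -
  have "i < start (Suc i)" using le_start[of "Suc i"] by simp
  then show ?thesis unfolding hi_def block_of_def by (rule LeastI)
qed

lemma lo_le_block_of: "lo i \<le> i"
proof (cases "block_of i")
  case 0
  then show ?thesis by (simp add: lo_def start_def)
next
  case (Suc k)
  then have "\<not> i < start (Suc k)" using not_less_Least[of k "\<lambda>k. i < start (Suc k)"] by (simp add: block_of_def)
  then show ?thesis by (simp add: lo_def Suc)
qed

lemma block_of_le_iff: "block_of i < k \<longleftrightarrow> i < start k"
proof
  assume "block_of i < k"
  then have "hi i \<le> start k" unfolding hi_def by (simp add: start_le_iff)
  then show "i < start k" using less_hi_block_of[of i] by simp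
next
  assume "i < start k"
  then have "start (block_of i) < start k" using lo_le_block_of[of i] by (simp add: lo_def)
  then show "block_of i < k" by (simp add: strict_mono_less[OF strict_mono_start])
qed

lemma block_of_eq_iff:
  "block_of i = k \<longleftrightarrow> start k \<le> i \<and> i < start (Suc k)"
  using block_of_le_iff[of i k] block_of_le_iff[of i "Suc k"] by linarith

sublocale partition: interval_partition lo hi
proof
  show "lo i \<le> i" "i < hi i" for i by (rule lo_le_block_of, rule less_hi_block_of)
  show "lo j = lo i \<and> hi j = hi i" if "lo i \<le> j" "j < hi i" for i j
    using that block_of_eq_iff[of j "block_of i"] by (simp add: lo_def hi_def)
qed

text \<open>
  The norm of the indicator function of the \<open>k\<close>-th interval. Divided by it, the indicators of the
  intervals \<open>a\<close> to \<open>b - 1\<close> add up to \<open>block_sum a b\<close> below.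
\<close>

definition block_norm :: "nat \<Rightarrow> real" where
  "block_norm k = weight_sum (len k) powr (1/p)"

lemma weight_sum_len_ge_1: "1 \<le> weight_sum (len k)"
  using len_ge_2[of k] by (intro weight_sum_ge_1) simp

lemma block_norm_powr: "block_norm k powr p = weight_sum (len k)"
  unfolding block_norm_def by (rule root_powr_p[OF weight_sum_nonneg])

lemma block_norm_pos: "0 < block_norm k"
  using weight_sum_len_ge_1[of k] by (simp add: block_norm_def)

definition block_sum :: "nat \<Rightarrow> nat \<Rightarrow> nat \<Rightarrow> 'a::real_normed_field" where
  "block_sum a b i = (if a \<le> block_of i \<and> block_of i < b then of_real (1 / block_norm (block_of i)) else 0)"

lemma block_sum_X: "block_sum a b \<in> X"
proof (rule X_finite_support)
  fix i assume "start b \<le> i"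
  then show "block_sum a b i = 0" by (simp add: block_sum_def block_of_le_iff)
qed

text \<open>
  Consider the first interval of the group from which a given set takes more than its threshold
  \<open>t\<close>. It contributes at most 1. Earlier intervals contribute little since few of their elements
  are taken, later ones since their elements have large rank.
\<close>

lemma N_block_sum_group:
  "N (block_sum a (group_end a) :: nat \<Rightarrow> 'a::real_normed_field) \<le> 3"
proof -
  let ?u = "block_sum a (group_end a) :: nat \<Rightarrow> 'a"
  define F where "F = {a..<group_end a}"
  define r where "r k = group_end a - Suc k" for k
  have len_F: "len k = q (r k)" if "k \<in> F" for k
    using that same_group[of a k] by (simp add: F_def len_def r_def)
  have "wsum ?u A \<le> 3 powr p" if A: "finite A" for A
  proof -
    define Ak where "Ak k = {x \<in> A. block_of x = k}" for k
    define c where "c k = (\<Sum>x\<in>Ak k. w (rank_in A x)) / weight_sum (len k)" for k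
    have fin: "finite (Ak k)" for k using A by (simp add: Ak_def)
    have "wsum ?u A = (\<Sum>x\<in>{x\<in>A. block_of x \<in> F}. norm (?u x) powr p * w (rank_in A x))"
      unfolding wsum_def using A p by (intro sum.mono_neutral_right) (auto simp: block_sum_def F_def)
    also have "\<dots> = (\<Sum>x\<in>{x\<in>A. block_of x \<in> F}. w (rank_in A x) / weight_sum (len (block_of x)))"
    proof (rule sum.cong[OF refl])
      fix x assume "x \<in> {x\<in>A. block_of x \<in> F}"
      then have "norm (?u x) = 1 / block_norm (block_of x)"
        using block_norm_pos[of "block_of x"] by (simp add: block_sum_def F_def norm_divide)
      then show "norm (?u x) powr p * w (rank_in A x) = w (rank_in A x) / weight_sum (len (block_of x))"
        using block_norm_pos[of "block_of x"] by (simp add: powr_divide block_norm_powr)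
    qed
    also have "\<dots> = (\<Sum>k\<in>F. \<Sum>x\<in>{x \<in> {x\<in>A. block_of x \<in> F}. block_of x = k}. w (rank_in A x) / weight_sum (len (block_of x)))"
      using A by (intro sum.group[symmetric]) (auto simp: F_def)
    also have "\<dots> = (\<Sum>k\<in>F. c k)"
      unfolding c_def sum_divide_distrib by (intro sum.cong) (auto simp: Ak_def)
    finally have total: "wsum ?u A = (\<Sum>k\<in>F. c k)" .
    have c_le_weight_sum: "c k \<le> weight_sum (card (Ak k)) / weight_sum (len k)" for k
    proof -
      have "(\<Sum>x\<in>Ak k. w (rank_in A x)) \<le> (\<Sum>x\<in>Ak k. w (rank_in (Ak k) x))"
        by (intro sum_mono w_mono) (auto simp: rank_in_def Ak_def A intro!: card_mono)
      also have "\<dots> = weight_sum (card (Ak k))" unfolding weight_sum_def by (rule sum_rank_in[OF fin])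
      finally show ?thesis unfolding c_def using weight_sum_nonneg by (intro divide_right_mono)
    qed
    have card_le: "card (Ak k) \<le> len k" for k
    proof -
      have "Ak k \<subseteq> {start k..<start (Suc k)}" by (auto simp: Ak_def block_of_eq_iff)
      from card_mono[OF _ this] show ?thesis by (simp add: start_Suc)
    qed
    have c_le_1: "c k \<le> 1" for k
      using c_le_weight_sum[of k] weight_sum_mono[OF card_le, of k] weight_sum_len_ge_1[of k]
      by (smt (verit) divide_le_eq_1)
    have few: "c k \<le> (1/2) ^ r k" if "k \<in> F" "card (Ak k) \<le> t (r k)" for k
    proof -
      have "weight_sum (card (Ak k)) \<le> (1/2) ^ r k * weight_sum (len k)"
        using weight_sum_mono[OF that(2)] few_small[of "r k"] len_F[OF that(1)] by simp
      then have "weight_sum (card (Ak k)) / weight_sum (len k) \<le> (1/2) ^ r k"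
        using weight_sum_len_ge_1[of k] by (simp add: divide_le_eq)
      with c_le_weight_sum[of k] show ?thesis by simp
    qed
    have late: "c k \<le> (1/2) ^ r k"
      if "k \<in> F" "k1 \<in> F" "k1 < k" "t (r k1) < card (Ak k1)" for k k1
    proof -
      have "w (rank_in A x) \<le> w (t (r k1))" if "x \<in> Ak k" for x
      proof -
        have "start (Suc k1) \<le> start k" using \<open>k1 < k\<close> by (simp add: start_le_iff)
        then have "Ak k1 \<subseteq> A \<inter> {..<x}" using that by (auto simp: Ak_def block_of_eq_iff)
        then have "card (Ak k1) \<le> rank_in A x" unfolding rank_in_def using A by (intro card_mono) auto
        then show ?thesis using \<open>t (r k1) < card (Ak k1)\<close> by (intro w_mono) simp
      qed
      then have "(\<Sum>x\<in>Ak k. w (rank_in A x)) \<le> card (Ak k) * w (t (r k1))"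
        using sum_bounded_above[of "Ak k" "\<lambda>x. w (rank_in A x)" "w (t (r k1))"] by simp
      also have "\<dots> \<le> q (r k) * w (t (r k1))"
        using card_le[of k] len_F[OF \<open>k \<in> F\<close>] by (intro mult_right_mono w_nonneg) simp
      also have "\<dots> \<le> (1/2) ^ r k" using that by (intro late_small) (auto simp: r_def F_def)
      finally have "c k \<le> (1/2) ^ r k / weight_sum (len k)"
        unfolding c_def using weight_sum_nonneg by (intro divide_right_mono)
      also have "\<dots> \<le> (1/2) ^ r k" using weight_sum_len_ge_1[of k] by (simp add: divide_le_eq)
      finally show ?thesis .
    qed
    have "\<exists>k1. \<forall>k\<in>F. c k \<le> (1/2) ^ r k + (if k = k1 then 1 else 0)"
    proof (cases "\<exists>k\<in>F. t (r k) < card (Ak k)")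
      case False
      then show ?thesis using few by (intro exI[of _ 0]) (auto simp: not_less intro: add_increasing2)
    next
      case True
      define k1 where "k1 = (LEAST k. k \<in> F \<and> t (r k) < card (Ak k))"
      have k1: "k1 \<in> F" "t (r k1) < card (Ak k1)"
        using LeastI_ex[of "\<lambda>k. k \<in> F \<and> t (r k) < card (Ak k)"] True by (auto simp: k1_def)
      have "card (Ak k) \<le> t (r k)" if "k \<in> F" "k < k1" for k
        using not_less_Least[of k "\<lambda>k. k \<in> F \<and> t (r k) < card (Ak k)"] that by (auto simp: k1_def)
      then have "c k \<le> (1/2) ^ r k + (if k = k1 then 1 else 0)" if "k \<in> F" for k
        using few[OF that] late[OF that k1(1) _ k1(2)] c_le_1[of k] that
        by (cases k k1 rule: linorder_cases) (auto intro: add_increasing)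
      then show ?thesis by blast
    qed
    then obtain k1 where k1: "\<And>k. k \<in> F \<Longrightarrow> c k \<le> (1/2) ^ r k + (if k = k1 then 1 else 0)" by blast
    have "wsum ?u A \<le> (\<Sum>k\<in>F. (1/2) ^ r k) + (\<Sum>k\<in>F. if k = k1 then 1 else 0)"
      unfolding total sum.distrib[symmetric] by (intro sum_mono k1)
    also have "(\<Sum>k\<in>F. (1/2::real) ^ r k) \<le> 2"
      unfolding F_def r_def by (rule half_powers_sum_le)
    also have "(\<Sum>k\<in>F. if k = k1 then 1 else 0) \<le> (1::real)" by (simp add: F_def)
    also have "2 + 1 = (3::real)" by simp
    also have "(3::real) \<le> 3 powr p" using p powr_mono[of 1 p "3::real"] by simp
    finally show ?thesis by simp
  qed
  then show ?thesis using garling_boundI(2)[of 3 ?u] by simp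
qed

end

section \<open>The basis and its partial sum operators\<close>

lemma avg_mult: "of_nat (b - a) * avg a b f = (\<Sum>j\<in>{a..<b}. f j)"
  by (cases "a < b") (simp_all add: avg_def del: of_nat_diff)

lemma avg_split_first:
  assumes "a < b"
  shows "of_nat (b - a) * avg a b f = f a + of_nat (b - Suc a) * avg (Suc a) b f"
  unfolding avg_mult using assms by (rule sum.atLeast_Suc_lessThan)

context garling_blocks
begin

text \<open>
  The identity before \<open>y\<close>, the mean over the rest of the interval of \<open>y\<close>, and the mean over each
  later interval. This is again an averaging operator, for the partition in which the points
  before \<open>y\<close> are separate and the interval of \<open>y\<close> is cut at \<open>y\<close>. For \<open>y = 0\<close> it is the projection
  onto the sequences that are constant on every interval.
\<close>

definition tail_averaging :: "nat \<Rightarrow> (nat \<Rightarrow> 'a::real_normed_field) \<Rightarrow> nat \<Rightarrow> 'a" where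
  "tail_averaging y f i = (if i < y then f i else avg (max y (lo i)) (hi i) f)"

lemma
  assumes "f \<in> X"
  shows tail_averaging_X: "tail_averaging y f \<in> X" and N_tail_averaging: "N (tail_averaging y f) \<le> 2 * N f"
proof -
  let ?lo = "\<lambda>i. if i < y then i else max y (lo i)"
  let ?hi = "\<lambda>i. if i < y then Suc i else hi i"
  have part: "interval_partition ?lo ?hi"
  proof
    show "?lo i \<le> i" for i using partition.lo_le[of i] by auto
    show "i < ?hi i" for i using partition.less_hi[of i] by auto
    show "?lo j = ?lo i \<and> ?hi j = ?hi i" if "?lo i \<le> j" "j < ?hi i" for i j
      using that partition.same_interval[of i j] by (auto split: if_splits)
  qed
  have "interval_partition.averaging ?lo ?hi f = tail_averaging y f"
    by (rule ext) (auto simp: interval_partition.averaging_def[OF part] tail_averaging_def avg_def)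
  then show "tail_averaging y f \<in> X" "N (tail_averaging y f) \<le> 2 * N f"
    using X_averaging[OF part assms] N_averaging[OF part assms] by auto
qed

text \<open>
  These are the increments of the averaging operators (\<open>tail_averaging_Suc\<close>): passing from \<open>y\<close> to
  \<open>Suc y\<close> splits a mean into the value at \<open>y\<close> and the mean over the remaining points, a change of
  rank one. At the last point of an interval there is nothing to split.
\<close>

definition diff_vec :: "nat \<Rightarrow> nat \<Rightarrow> 'a::real_normed_field" where
  "diff_vec j i = (if i = j then 1 else if j < i \<and> i < hi j then - 1 / of_nat (hi j - Suc j) else 0)"

definition diff_coeff :: "nat \<Rightarrow> (nat \<Rightarrow> 'a::real_normed_field) \<Rightarrow> 'a" where
  "diff_coeff j f = f j - avg j (hi j) f"

lemma hi_eq: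
  "j \<le> i \<Longrightarrow> i < hi j \<Longrightarrow> hi i = hi j" and lo_eq: "j \<le> i \<Longrightarrow> i < hi j \<Longrightarrow> lo i = lo j"
  using partition.same_interval[of j i] partition.lo_le[of j] by auto

lemma tail_averaging_Suc:
  "tail_averaging (Suc y) f i = tail_averaging y f i + (if Suc y = hi y then 0 else diff_coeff y f * diff_vec y i)"
proof -
  have y: "lo y \<le> y" "y < hi y" by (rule partition.lo_le, rule partition.less_hi)
  consider "i < y" | "i = y" | "y < i" "i < hi y" | "y < i" "hi y \<le> i" by linarith
  then show ?thesis
  proof cases
    case 1
    then show ?thesis by (simp add: tail_averaging_def diff_vec_def)
  next
    case 2
    have "avg y (hi y) f = f y" if h: "Suc y = hi y"
    proof (rule avg_const[OF _ y(2)])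
      fix j assume "y \<le> j" "j < hi y"
      with h have "j = y" by linarith
      then show "f j = f y" by simp
    qed
    then show ?thesis using 2 y by (auto simp: tail_averaging_def diff_vec_def diff_coeff_def max_def)
  next
    case 3
    then have i: "hi i = hi y" "lo i = lo y" using hi_eq[of y i] lo_eq[of y i] by auto
    define m where "m = hi y - Suc y"
    have m: "0 < m" "hi y - y = Suc m" using 3 by (auto simp: m_def)
    let ?A = "avg y (hi y) f" and ?A' = "avg (Suc y) (hi y) f"
    have "of_nat (Suc m) * ?A = f y + of_nat m * ?A'"
      using avg_split_first[of y "hi y" f] m y(2) by (simp add: m_def)
    then have "of_nat m * ?A' = of_nat m * ?A - (f y - ?A)" by (simp add: algebra_simps)
    then have "?A' = ?A + (f y - ?A) * (- 1 / of_nat m)" using m by (simp add: field_simps)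
    then show ?thesis using 3 i y by (simp add: tail_averaging_def diff_vec_def diff_coeff_def max_def m_def)
  next
    case 4
    have "hi y \<le> lo i"
      by (rule partition.hi_le_lo[OF \<open>y < i\<close>])
        (use 4 partition.same_interval[of i y] partition.less_hi[of i] y in force)
    then show ?thesis using 4 y by (simp add: tail_averaging_def diff_vec_def max_def)
  qed
qed

lemma avg_diff_vec:
  assumes "lo j \<le> a" "a \<le> j" "Suc j \<noteq> hi j"
  shows "avg a (hi j) (diff_vec j :: nat \<Rightarrow> 'a::real_normed_field) = 0"
proof -
  have h: "Suc j < hi j" using partition.less_hi[of j] assms by linarith
  have "(\<Sum>i\<in>{a..<hi j}. diff_vec j i :: 'a) = (\<Sum>i\<in>{j..<hi j}. diff_vec j i)"
    using assms by (intro sum.mono_neutral_right) (auto simp: diff_vec_def)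
  also have "\<dots> = diff_vec j j + (\<Sum>i\<in>{Suc j..<hi j}. diff_vec j i)"
    using h by (intro sum.atLeast_Suc_lessThan) simp
  also have "(\<Sum>i\<in>{Suc j..<hi j}. diff_vec j i :: 'a) = (\<Sum>i\<in>{Suc j..<hi j}. - 1 / of_nat (hi j - Suc j))"
    by (intro sum.cong) (auto simp: diff_vec_def)
  also have "\<dots> = - 1" using h by (simp del: of_nat_diff)
  finally show ?thesis by (simp add: avg_def diff_vec_def)
qed

text \<open>
  The coefficient of the \<open>k\<close>-th normalized indicator in the projection onto the sequences constant
  on intervals.
\<close>

definition block_coord :: "nat \<Rightarrow> (nat \<Rightarrow> 'a::real_normed_field) \<Rightarrow> 'a" where
  "block_coord k f = of_real (block_norm k) * avg (start k) (start (Suc k)) f"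

lemma tail_averaging_0:
  "tail_averaging 0 f i = avg (start (block_of i)) (start (Suc (block_of i))) f"
  by (simp add: tail_averaging_def lo_def hi_def)

lemma tail_averaging_0_eq:
  "tail_averaging 0 f i = block_coord (block_of i) f * of_real (1 / block_norm (block_of i))"
  using block_norm_pos[of "block_of i"] by (simp add: tail_averaging_0 block_coord_def)

lemma norm_block_coord_le:
  assumes "f \<in> X"
  shows "norm (block_coord k f) \<le> 2 * N f"
proof -
  define J where "J = {start k..<start (Suc k)}"
  have "wsum (tail_averaging 0 f) J = (\<Sum>i\<in>J. norm (avg (start k) (start (Suc k)) f) powr p * w (rank_in J i))"
    unfolding wsum_def by (intro sum.cong) (auto simp: tail_averaging_0 J_def block_of_eq_iff[THEN iffD2])
  also have "\<dots> = norm (avg (start k) (start (Suc k)) f) powr p * (\<Sum>i\<in>J. w (rank_in J i))"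
    by (simp add: sum_distrib_left)
  also have "(\<Sum>i\<in>J. w (rank_in J i)) = block_norm k powr p"
    using sum_rank_in[of J w] by (simp add: J_def block_norm_powr weight_sum_def start_Suc)
  also have "norm (avg (start k) (start (Suc k)) f) powr p * block_norm k powr p = norm (block_coord k f) powr p"
    using block_norm_pos[of k] by (simp add: block_coord_def norm_mult powr_mult mult.commute)
  finally have "norm (block_coord k f) powr p \<le> N (tail_averaging 0 f) powr p"
    using wsum_le_N[OF tail_averaging_X[OF assms], of J 0] by (simp add: J_def)
  then have "norm (block_coord k f) \<le> N (tail_averaging 0 f)"
    by (simp add: powr_p_le_iff N_nonneg tail_averaging_X assms)
  with N_tail_averaging[OF assms, of 0] show ?thesis by simp
qed

definition summing_vec :: "nat \<Rightarrow> nat \<Rightarrow> 'a::real_normed_field" where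
  "summing_vec k = block_sum k (group_end k)"

text \<open>
  In the coordinates \<open>x\<^sub>k\<close> with respect to the normalized indicators, the coefficient of the
  summing vector number \<open>k\<close> is \<open>x\<^sub>k - x\<^sub>k\<^sub>-\<^sub>1\<close>, and \<open>x\<^sub>k\<close> if \<open>k\<close> is the first of its group.
\<close>

definition summing_coeff :: "nat \<Rightarrow> (nat \<Rightarrow> 'a::real_normed_field) \<Rightarrow> 'a" where
  "summing_coeff k f = block_coord k f - (if 0 < k \<and> k < group_end (k - 1) then block_coord (k - 1) f else 0)"

text \<open>
  Partial summation telescopes: the coordinates before \<open>x\<close> are reproduced, and inside the group of
  \<open>x - 1\<close> the last coordinate reached is continued as a constant. That constant multiplies a sum
  of normalized indicators from one group, which is bounded by \<open>N_block_sum_group\<close>.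
\<close>

lemma sum_summing_vec:
  "(\<Sum>k<x. summing_coeff k f * summing_vec k i) = (if block_of i < x then tail_averaging 0 f i else 0)
     + (if 0 < x then block_coord (x - 1) f * block_sum x (group_end (x - 1)) i else 0)"
proof (induction x)
  case (Suc x)
  have ge: "x < group_end x" by (rule less_group_end)
  have same: "group_end x = group_end (x - 1)" if "0 < x" "x < group_end (x - 1)"
    using that same_group[of "x - 1" x] by simp
  have "(\<Sum>k<Suc x. summing_coeff k f * summing_vec k i) = (if block_of i < x then tail_averaging 0 f i else 0)
     + (if 0 < x then block_coord (x - 1) f * block_sum x (group_end (x - 1)) i else 0) + summing_coeff x f * summing_vec x i"
    using Suc by simp
  also have "\<dots> = (if block_of i < Suc x then tail_averaging 0 f i else 0) + block_coord x f * block_sum (Suc x) (group_end x) i"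
  proof (cases "0 < x \<and> x < group_end (x - 1)")
    case True
    with ge same show ?thesis
      by (cases "block_of i" x rule: linorder_cases)
        (auto simp: summing_vec_def summing_coeff_def block_sum_def tail_averaging_0_eq algebra_simps)
  next
    case False
    with ge show ?thesis
      by (cases "block_of i" x rule: linorder_cases)
        (auto simp: summing_vec_def summing_coeff_def block_sum_def tail_averaging_0_eq algebra_simps)
  qed
  finally show ?case by simp
qed simp

lemma summing_vec_X: "summing_vec k \<in> X"
  by (simp add: summing_vec_def block_sum_X)

lemma N_summing_vec: "N (summing_vec k :: nat \<Rightarrow> 'a::real_normed_field) \<le> 3"
  unfolding summing_vec_def by (rule N_block_sum_group)

lemma N_sum_summing_vec:
  assumes f: "f \<in> X"
  shows "N (\<lambda>i. \<Sum>k<x. summing_coeff k f * summing_vec k i) \<le> 8 * N f"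
proof -
  let ?g = "\<lambda>i. if block_of i < x then tail_averaging 0 f i else 0"
  let ?h = "\<lambda>i. block_coord (x - 1) f * block_sum x (group_end (x - 1)) i"
  have g_le: "norm (?g k) \<le> norm (tail_averaging 0 f k)" for k by simp
  have g: "?g \<in> X" "N ?g \<le> 2 * N f"
    using garling_comparison[OF tail_averaging_X[OF f] g_le] N_tail_averaging[OF f, of 0] by auto
  have u: "N (block_sum x (group_end (x - 1)) :: nat \<Rightarrow> 'a) \<le> 3" if "0 < x"
  proof (cases "x < group_end (x - 1)")
    case True
    then have "group_end (x - 1) = group_end x" using same_group[of "x - 1" x] by simp
    then show ?thesis using N_block_sum_group[of x] by simp
  next
    case False
    then have "block_sum x (group_end (x - 1)) = (\<lambda>_. 0 :: 'a)" by (auto simp: block_sum_def)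
    then show ?thesis by (simp add: N_zero)
  qed
  have h: "?h \<in> X" by (rule X_scale[OF block_sum_X])
  show ?thesis
  proof (cases "x = 0")
    case True
    then show ?thesis by (simp add: N_zero N_nonneg[OF f])
  next
    case False
    have "N ?h \<le> norm (block_coord (x - 1) f) * N (block_sum x (group_end (x - 1)) :: nat \<Rightarrow> 'a)"
      by (rule N_scale_le[OF block_sum_X])
    also have "\<dots> \<le> (2 * N f) * 3"
      using False u norm_block_coord_le[OF f] N_nonneg[OF f] N_nonneg[OF block_sum_X]
      by (intro mult_mono) auto
    finally have "N ?h \<le> 6 * N f" by simp
    moreover have "(\<lambda>i. \<Sum>k<x. summing_coeff k f * summing_vec k i) = (\<lambda>i. ?g i + ?h i)"
      using False by (auto simp: sum_summing_vec)
    ultimately show ?thesis using N_triangle[OF g(1) h] g(2) by simp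
  qed
qed

text \<open>
  No vector of mean zero belongs to the last point of an interval, as the averaging operator does
  not change there.
\<close>

definition inner :: "nat set" where
  "inner = {j. Suc j \<noteq> hi j}"

lemma infinite_inner: "infinite inner"
proof -
  have "start k \<in> inner" for k
  proof -
    have "block_of (start k) = k" using strict_mono_start by (simp add: block_of_eq_iff strict_mono_less)
    then show ?thesis using len_ge_2[of k] by (auto simp: inner_def hi_def start_Suc)
  qed
  then have "range start \<subseteq> inner" by auto
  moreover have "infinite (range start)"
    using strict_mono_start by (simp add: range_inj_infinite strict_mono_imp_inj_on)
  ultimately show ?thesis using infinite_super by blast
qed

definition inner_index :: "nat \<Rightarrow> nat" where
  "inner_index = enumerate inner"

lemma inner_index_inner: "Suc (inner_index k) \<noteq> hi (inner_index k)"
  using enumerate_in_set[OF infinite_inner, of k] by (simp add: inner_index_def inner_def)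

lemma inner_index_inj: "inner_index k = inner_index l \<longleftrightarrow> k = l"
  using inj_enumerate[OF infinite_inner] by (auto simp: inner_index_def inj_on_def)

lemma le_inner_index: "k \<le> inner_index k"
  unfolding inner_index_def by (rule le_enumerate[OF infinite_inner])

lemma sum_diff_vec:
  "(\<Sum>k<n. diff_coeff (inner_index k) f * diff_vec (inner_index k) i) = tail_averaging (inner_index n) f i - tail_averaging 0 f i"
proof -
  have all: "(\<Sum>j\<in>inner \<inter> {..<y}. diff_coeff j f * diff_vec j i) = tail_averaging y f i - tail_averaging 0 f i" for y
  proof (induction y)
    case (Suc y)
    have "inner \<inter> {..<Suc y} = (if y \<in> inner then insert y (inner \<inter> {..<y}) else inner \<inter> {..<y})"
      by (auto simp: less_Suc_eq)
    then show ?case using Suc by (simp add: tail_averaging_Suc) (simp add: inner_def)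
  qed simp
  have "(\<Sum>k<n. diff_coeff (inner_index k) f * diff_vec (inner_index k) i) = (\<Sum>j\<in>inner_index ` {..<n}. diff_coeff j f * diff_vec j i)"
    by (subst sum.reindex) (auto simp: inj_on_def inner_index_inj)
  also have "inner_index ` {..<n} = inner \<inter> {..<inner_index n}"
    unfolding inner_index_def by (rule enumerate_initial_segment[OF infinite_inner, symmetric])
  finally show ?thesis by (simp add: all)
qed

text \<open>
  Strict alternation puts the first \<open>k\<close> summing vectors among the first \<open>2 * k\<close> basis vectors,
  which the linear growth requires. The partial sums are bounded for any way of interleaving.
\<close>

definition basis_vec :: "nat \<Rightarrow> nat \<Rightarrow> 'a::real_normed_field" where
  "basis_vec j = (if even j then summing_vec (j div 2) else diff_vec (inner_index (j div 2)))"

definition basis_coeff :: "nat \<Rightarrow> (nat \<Rightarrow> 'a::real_normed_field) \<Rightarrow> 'a" where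
  "basis_coeff j f = (if even j then summing_coeff (j div 2) f else diff_coeff (inner_index (j div 2)) f)"

definition partial_sum :: "nat \<Rightarrow> (nat \<Rightarrow> 'a::real_normed_field) \<Rightarrow> nat \<Rightarrow> 'a" where
  "partial_sum m f i = (\<Sum>j<m. basis_coeff j f * basis_vec j i)"

lemma partial_sum_split:
  "partial_sum m f i = (\<Sum>k<Suc m div 2. summing_coeff k f * summing_vec k i)
    + (\<Sum>k<m div 2. diff_coeff (inner_index k) f * diff_vec (inner_index k) i)"
proof (induction m)
  case (Suc m)
  show ?case
  proof (cases "even m")
    case True
    then have "Suc m div 2 = m div 2" "Suc (Suc m) div 2 = Suc (m div 2)" by auto
    with Suc True show ?thesis by (simp add: partial_sum_def basis_vec_def basis_coeff_def)
  next
    case False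
    then have "Suc m div 2 = Suc (m div 2)" "Suc (Suc m) div 2 = Suc (m div 2)" by auto
    with Suc False show ?thesis by (simp add: partial_sum_def basis_vec_def basis_coeff_def)
  qed
qed (simp add: partial_sum_def)

lemma partial_sum_eq:
  "partial_sum m f i = (\<Sum>k<Suc m div 2. summing_coeff k f * summing_vec k i) + (tail_averaging (inner_index (m div 2)) f i - tail_averaging 0 f i)"
  by (simp add: partial_sum_split sum_diff_vec)

lemma diff_vec_X: "diff_vec j \<in> X"
  by (rule X_finite_support[of "hi j"]) (use partition.less_hi[of j] in \<open>auto simp: diff_vec_def\<close>)

lemma basis_vec_X: "basis_vec j \<in> X"
  by (simp add: basis_vec_def summing_vec_X diff_vec_X)

lemma partial_sum_X: "partial_sum m f \<in> X"
  unfolding partial_sum_def[abs_def] by (intro X_sum X_scale basis_vec_X)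

lemma N_partial_sum:
  assumes f: "f \<in> X"
  shows "N (partial_sum m f) \<le> 12 * N f"
proof -
  let ?g = "\<lambda>i. \<Sum>k<Suc m div 2. summing_coeff k f * summing_vec k i"
  let ?h = "\<lambda>i. tail_averaging (inner_index (m div 2)) f i - tail_averaging 0 f i"
  have "?g \<in> X" by (intro X_sum X_scale summing_vec_X)
  moreover have "?h \<in> X" "N ?h \<le> 2 * N f + 2 * N f"
    using X_diff[OF tail_averaging_X[OF f] tail_averaging_X[OF f]] N_diff[OF tail_averaging_X[OF f] tail_averaging_X[OF f], of "inner_index (m div 2)" 0]
      N_tail_averaging[OF f, of "inner_index (m div 2)"] N_tail_averaging[OF f, of 0] by auto
  ultimately show ?thesis
    using N_triangle[of ?g ?h] N_sum_summing_vec[OF f, of "Suc m div 2"] by (simp add: partial_sum_eq[abs_def])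
qed

lemma norm_basis_coeff_le:
  assumes "f \<in> X"
  shows "norm (basis_coeff j f) \<le> 4 * N f"
proof -
  have "norm (summing_coeff k f) \<le> 4 * N f" for k
  proof -
    have "norm (summing_coeff k f) \<le> norm (block_coord k f) + norm (if 0 < k \<and> k < group_end (k - 1) then block_coord (k - 1) f else 0)"
      unfolding summing_coeff_def by (rule norm_triangle_ineq4)
    then show ?thesis
      using norm_block_coord_le[OF assms, of k] norm_block_coord_le[OF assms, of "k - 1"] N_nonneg[OF assms]
      by (auto split: if_splits)
  qed
  moreover have "norm (diff_coeff k f) \<le> 4 * N f" for k
  proof -
    have "avg k (hi k) f = tail_averaging k f k" using partition.lo_le[of k] by (simp add: tail_averaging_def max_def)
    then have "norm (avg k (hi k) f) \<le> 2 * N f"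
      using norm_le_N[OF tail_averaging_X[OF assms], of k k] N_tail_averaging[OF assms, of k] by simp
    moreover have "norm (diff_coeff k f) \<le> norm (f k) + norm (avg k (hi k) f)"
      unfolding diff_coeff_def by (rule norm_triangle_ineq4)
    ultimately show ?thesis using norm_le_N[OF assms, of k] N_nonneg[OF assms] by simp
  qed
  ultimately show ?thesis by (simp add: basis_coeff_def)
qed

text \<open>
  The increment of two averaging operators at the unit vector number \<open>j\<close> is a multiple of
  \<open>diff_vec j\<close>, with a factor of modulus at least \<open>1/2\<close> as the mean runs over at least two points.
\<close>

lemma N_diff_vec:
  assumes j: "Suc j \<noteq> hi j"
  shows "N (diff_vec j :: nat \<Rightarrow> 'a::real_normed_field) \<le> 8"
proof -
  define e :: "nat \<Rightarrow> 'a" where "e = (\<lambda>i. if i = j then 1 else 0)"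
  have e: "e \<in> X" by (rule X_finite_support[of "Suc j"]) (simp add: e_def)
  have "wsum e A \<le> 1 powr p" if A: "finite A" for A
  proof -
    have "wsum e A \<le> (\<Sum>a\<in>A. if a = j then 1 else 0)"
      unfolding wsum_def using w_mono[of 0] w0 p by (intro sum_mono) (auto simp: e_def)
    then show ?thesis using A by (simp split: if_splits)
  qed
  from garling_boundI(2)[OF _ this] have Ne: "N e \<le> 1" by simp
  have h: "Suc j < hi j" using j partition.less_hi[of j] by linarith
  define c where "c = diff_coeff j e"
  have "(\<Sum>i\<in>{j..<hi j}. e i) = 1" using h by (simp add: e_def)
  then have c: "c = 1 - 1 / of_nat (hi j - j)" by (simp add: c_def diff_coeff_def avg_def e_def)
  have nc: "1/2 \<le> norm c"
  proof -
    have "norm (1 / of_nat (hi j - j) :: 'a) \<le> 1/2"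
      using h by (simp add: norm_divide divide_simps del: of_nat_diff)
    then show ?thesis using norm_triangle_ineq2[of "1 :: 'a" "1 / of_nat (hi j - j)"] by (simp add: c)
  qed
  have eq: "(\<lambda>i. c * diff_vec j i) = (\<lambda>i. tail_averaging (Suc j) e i - tail_averaging j e i)"
    using j by (simp add: tail_averaging_Suc c_def)
  have cX: "(\<lambda>i. c * diff_vec j i) \<in> X" by (rule X_scale[OF diff_vec_X])
  have "c \<noteq> 0" using nc by auto
  then have "diff_vec j = (\<lambda>i. inverse c * (c * diff_vec j i))" by (simp add: mult.assoc[symmetric])
  then have "N (diff_vec j :: nat \<Rightarrow> 'a) \<le> norm (inverse c) * N (\<lambda>i. c * diff_vec j i)"
    using N_scale_le[OF cX, of "inverse c"] by simp
  also have "\<dots> \<le> 2 * (2 * N e + 2 * N e)"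
  proof (rule mult_mono)
    show "norm (inverse c) \<le> 2" using nc \<open>c \<noteq> 0\<close> by (simp add: inverse_eq_divide norm_divide divide_le_eq)
    show "N (\<lambda>i. c * diff_vec j i) \<le> 2 * N e + 2 * N e"
      unfolding eq using N_diff[OF tail_averaging_X[OF e] tail_averaging_X[OF e], of "Suc j" j] N_tail_averaging[OF e, of "Suc j"] N_tail_averaging[OF e, of j]
      by simp
  qed (auto simp: N_nonneg[OF cX])
  finally show ?thesis using Ne by simp
qed

lemma N_basis_vec: "N (basis_vec j :: nat \<Rightarrow> 'a::real_normed_field) \<le> 8"
  using N_summing_vec[where ?'a = 'a, of "j div 2"] N_diff_vec[where ?'a = 'a, OF inner_index_inner[of "j div 2"]]
  by (simp add: basis_vec_def)

section \<open>Biorthogonality and convergence of the expansions\<close>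

lemma basis_coeff_add: "basis_coeff j (\<lambda>k. f k + g k) = basis_coeff j f + basis_coeff j g"
  by (simp add: basis_coeff_def summing_coeff_def block_coord_def diff_coeff_def avg_add algebra_simps)

lemma basis_coeff_scale: "basis_coeff j (\<lambda>k. c * f k) = c * basis_coeff j f"
  by (simp add: basis_coeff_def summing_coeff_def block_coord_def diff_coeff_def avg_scale algebra_simps)

lemma basis_coeff_diff: "basis_coeff j (\<lambda>k. f k - g k) = basis_coeff j f - basis_coeff j g"
  using basis_coeff_add[of j f "\<lambda>k. - 1 * g k"] basis_coeff_scale[of j "- 1" g] by simp

lemma basis_coeff_zero: "basis_coeff j (\<lambda>_. 0) = 0"
  using basis_coeff_scale[of j 0 "\<lambda>_. 0"] by simp

lemma basis_coeff_sum:
  "finite I \<Longrightarrow> basis_coeff j (\<lambda>k. \<Sum>i\<in>I. c i * u i k) = (\<Sum>i\<in>I. c i * basis_coeff j (u i))"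
  by (induction I rule: finite_induct) (simp_all add: basis_coeff_zero basis_coeff_add basis_coeff_scale)

lemma partial_sum_diff:
  "partial_sum m (\<lambda>k. f k - g k) i = partial_sum m f i - partial_sum m g i"
  by (simp add: partial_sum_def basis_coeff_diff left_diff_distrib sum_subtractf)

lemma avg_block: "avg (start k) (start (Suc k)) f = avg (lo j) (hi j) f" if "block_of j = k"
  using that by (simp add: lo_def hi_def)

lemma start_less_Suc: "start k < start (Suc k)"
  using strict_mono_start by (simp add: strict_mono_less)

lemma block_coord_blockwise_const:
  assumes "\<And>i. block_of i = k \<Longrightarrow> f i = c * of_real (1 / block_norm k)"
  shows "block_coord k f = c"
proof -
  have "avg (start k) (start (Suc k)) f = c * of_real (1 / block_norm k)"
    by (rule avg_const[OF assms start_less_Suc]) (simp add: block_of_eq_iff)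
  then show ?thesis using block_norm_pos[of k] by (simp add: block_coord_def)
qed

lemma diff_coeff_blockwise_const:
  assumes "\<And>i. j \<le> i \<Longrightarrow> i < hi j \<Longrightarrow> f i = f j"
  shows "diff_coeff j f = 0"
  using avg_const[OF assms partition.less_hi] by (simp add: diff_coeff_def)

lemma block_of_eq: "j \<le> i \<Longrightarrow> i < hi j \<Longrightarrow> block_of i = block_of j"
  using lo_le_block_of[of j] block_of_eq_iff[of i "block_of j"] by (simp add: lo_def hi_def)

lemma block_coord_summing_vec:
  "block_coord k (summing_vec l) = (if l \<le> k \<and> k < group_end l then 1 else 0)"
  by (rule block_coord_blockwise_const) (simp add: summing_vec_def block_sum_def)

lemma summing_coeff_summing_vec: "summing_coeff k (summing_vec l) = (if k = l then 1 else 0)"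
proof -
  consider "k < l" | "k = l" | "l < k" "k - 1 < group_end l" | "l < k" "group_end l \<le> k - 1" by linarith
  then show ?thesis
  proof cases
    case 2
    then show ?thesis using less_group_end[of l] by (auto simp: summing_coeff_def block_coord_summing_vec)
  next
    case 3
    then have "group_end (k - 1) = group_end l" by (intro same_group) auto
    with 3 show ?thesis by (auto simp: summing_coeff_def block_coord_summing_vec)
  qed (auto simp: summing_coeff_def block_coord_summing_vec)
qed

lemma diff_coeff_summing_vec: "diff_coeff j (summing_vec k) = 0"
  by (rule diff_coeff_blockwise_const) (simp add: summing_vec_def block_sum_def block_of_eq)

lemma block_coord_diff_vec:
  assumes "Suc j \<noteq> hi j"
  shows "block_coord k (diff_vec j :: nat \<Rightarrow> 'a::real_normed_field) = 0"
proof (cases "block_of j = k")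
  case True
  then show ?thesis
    using avg_diff_vec[OF order_refl lo_le_block_of assms, where ?'a = 'a]
    by (simp add: block_coord_def avg_block[OF True])
next
  case False
  have "(diff_vec j i :: 'a) = 0" if "start k \<le> i" "i < start (Suc k)" for i
  proof -
    have "block_of i = k" using that by (simp add: block_of_eq_iff)
    then show ?thesis using False block_of_eq[of j i] by (auto simp: diff_vec_def)
  qed
  then show ?thesis by (simp add: block_coord_def avg_zero)
qed

lemma diff_coeff_diff_vec:
  assumes i: "Suc i \<noteq> hi i"
  shows "diff_coeff j (diff_vec i :: nat \<Rightarrow> 'a::real_normed_field) = (if i = j then 1 else 0)"
proof -
  consider "i = j" | "j < i" "i < hi j" | "j < i" "hi j \<le> i" | "i < j" by linarith
  then show ?thesis
  proof cases
    case 1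
    then show ?thesis
      using avg_diff_vec[OF lo_le_block_of order_refl i, where ?'a = 'a] by (simp add: diff_coeff_def diff_vec_def)
  next
    case 2
    then have "hi i = hi j" "lo i = lo j" using hi_eq[of j i] lo_eq[of j i] by auto
    then have "avg j (hi j) (diff_vec i :: nat \<Rightarrow> 'a) = 0"
      using avg_diff_vec[of i j, OF _ _ i, where ?'a = 'a] 2 lo_le_block_of[of j] by simp
    then show ?thesis using 2 by (simp add: diff_coeff_def diff_vec_def)
  next
    case 3
    then show ?thesis using partition.less_hi[of j] by (simp add: diff_coeff_def diff_vec_def avg_zero)
  next
    case 4
    have "(diff_vec i k :: 'a) = diff_vec i j" if k: "j \<le> k" "k < hi j" for k
    proof (cases "j < hi i")
      case True
      then have "hi i = hi j" using hi_eq[of i j] 4 by simp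
      then show ?thesis using True 4 k by (simp add: diff_vec_def)
    next
      case False
      then show ?thesis using 4 k by (simp add: diff_vec_def)
    qed
    then have "diff_coeff j (diff_vec i :: nat \<Rightarrow> 'a) = 0" by (rule diff_coeff_blockwise_const)
    then show ?thesis using 4 by simp
  qed
qed

lemma basis_coeff_basis_vec: "basis_coeff i (basis_vec j) = (if i = j then 1 else 0)"
proof -
  have "summing_coeff k (diff_vec (inner_index l)) = 0" for k l
    by (simp add: summing_coeff_def block_coord_diff_vec[OF inner_index_inner])
  moreover have "even i \<Longrightarrow> even j \<Longrightarrow> i div 2 = j div 2 \<longleftrightarrow> i = j"
    "odd i \<Longrightarrow> odd j \<Longrightarrow> i div 2 = j div 2 \<longleftrightarrow> i = j" by presburger+
  ultimately show ?thesis
    by (auto simp: basis_coeff_def basis_vec_def summing_coeff_summing_vec diff_coeff_summing_vec diff_coeff_diff_vec[OF inner_index_inner] inner_index_inj)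
qed

text \<open>
  Once all indices up to \<open>n\<close> have been passed in both families, the summing vectors contribute the
  projection of \<open>f\<close> and the vectors of mean zero contribute the rest of \<open>f\<close>.
\<close>

lemma partial_sum_eventually_id:
  assumes f: "\<And>k. n \<le> k \<Longrightarrow> f k = 0" and m: "2 * n + 2 \<le> m"
  shows "partial_sum m f i = f i"
proof -
  define x where "x = Suc m div 2"
  have x: "n < x" "n \<le> x - 1" "0 < x" using m by (auto simp: x_def)
  have block_coord0: "block_coord k f = 0" if "n \<le> k" for k
  proof -
    have "n \<le> start k" using that le_start[of k] by simp
    then show ?thesis by (simp add: block_coord_def avg_zero f)
  qed
  have "n \<le> inner_index (m div 2)" using le_inner_index[of "m div 2"] m by linarith
  then have "tail_averaging (inner_index (m div 2)) f i = f i" by (auto simp: tail_averaging_def avg_zero f)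
  moreover have "(\<Sum>k<x. summing_coeff k f * summing_vec k i) = tail_averaging 0 f i"
    using x by (auto simp: sum_summing_vec block_coord0 tail_averaging_0_eq)
  ultimately show ?thesis by (simp add: partial_sum_eq x_def)
qed

lemma partial_sum_tendsto:
  assumes f: "f \<in> X"
  shows "(\<lambda>m. N (\<lambda>k. f k - partial_sum m f k)) \<longlonglongrightarrow> 0"
proof -
  have key: "N (\<lambda>k. f k - partial_sum m f k) \<le> 13 * N (tail n f)" if m: "2 * n + 2 \<le> m" for m n
  proof -
    let ?g = "tail n f" and ?h = "\<lambda>k. f k - tail n f k"
    have "partial_sum m ?h i = ?h i" for i by (rule partial_sum_eventually_id[OF _ m]) (simp add: tail_def)
    then have "(\<lambda>k. f k - partial_sum m f k) = (\<lambda>k. ?g k - partial_sum m ?g k)"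
      by (auto simp: partial_sum_diff algebra_simps)
    then show ?thesis
      using N_diff[OF tail_X[OF f, of n] partial_sum_X[of m ?g]] N_partial_sum[OF tail_X[OF f, of n], of m] by simp
  qed
  show ?thesis
  proof (rule LIMSEQ_I)
    fix e :: real assume e: "0 < e"
    have "\<forall>\<^sub>F n in sequentially. N (tail n f) < e / 13"
      using N_tail_tendsto[OF f] e by (intro order_tendstoD) auto
    then obtain n where n: "N (tail n f) < e / 13"
      using eventually_happens trivial_limit_sequentially by blast
    have "norm (N (\<lambda>k. f k - partial_sum m f k) - 0) < e" if "2 * n + 2 \<le> m" for m
      using key[OF that] n N_nonneg[OF X_diff[OF f partial_sum_X[of m f]]] by simp
    then show "\<exists>m0. \<forall>m\<ge>m0. norm (N (\<lambda>k. f k - partial_sum m f k) - 0) < e" by blast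
  qed
qed

text \<open>
  Uniqueness is read off from the coefficient functionals: they are bounded, hence may be applied
  to the limit, and biorthogonal to the basis vectors.
\<close>

lemma is_expansion_iff:
  assumes f: "f \<in> X"
  shows "is_expansion N basis_vec f a \<longleftrightarrow> a = (\<lambda>j. basis_coeff j f)"
proof
  assume "a = (\<lambda>j. basis_coeff j f)"
  then show "is_expansion N basis_vec f a"
    using partial_sum_tendsto[OF f] by (simp add: is_expansion_def series_converges_to_def partial_sum_def)
next
  assume "is_expansion N basis_vec f a"
  then have lim: "(\<lambda>n. N (\<lambda>k. f k - (\<Sum>j<n. a j * basis_vec j k))) \<longlonglongrightarrow> 0"
    by (simp add: is_expansion_def series_converges_to_def)
  have "basis_coeff i f - a i = 0" for i
  proof -
    have le: "norm (basis_coeff i f - a i) \<le> 4 * N (\<lambda>k. f k - (\<Sum>j<n. a j * basis_vec j k))" if "i < n" for n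
    proof -
      have "basis_coeff i (\<lambda>k. f k - (\<Sum>j<n. a j * basis_vec j k)) = basis_coeff i f - a i"
        using that by (simp add: basis_coeff_diff basis_coeff_sum basis_coeff_basis_vec if_distrib cong: if_cong)
      moreover have "(\<lambda>k. f k - (\<Sum>j<n. a j * basis_vec j k)) \<in> X"
        by (intro X_diff f X_sum X_scale basis_vec_X)
      ultimately show ?thesis using norm_basis_coeff_le by metis
    qed
    have "(\<lambda>n. 4 * N (\<lambda>k. f k - (\<Sum>j<n. a j * basis_vec j k))) \<longlonglongrightarrow> 4 * 0"
      by (intro tendsto_mult lim tendsto_const)
    then have "norm (basis_coeff i f - a i) \<le> 4 * 0"
      by (rule tendsto_lowerbound) (auto simp: eventually_sequentially intro!: exI[of _ "Suc i"] le)
    then show ?thesis by simp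
  qed
  then show "a = (\<lambda>j. basis_coeff j f)" by auto
qed

lemma schauder_basis_vec: "schauder_basis X N basis_vec"
  by (auto simp: schauder_basis_def basis_vec_X is_expansion_iff)

lemma coeffs_basis_vec:
  "f \<in> X \<Longrightarrow> coeffs N basis_vec f = (\<lambda>j. basis_coeff j f)"
  by (simp add: coeffs_def is_expansion_iff)

lemma supp_basis_vec:
  "f \<in> X \<Longrightarrow> supp N basis_vec f = {j. basis_coeff j f \<noteq> 0}"
  by (simp add: supp_def coeffs_basis_vec)

section \<open>Alternating sums of the summing vectors\<close>

text \<open>
  Every other member of each group, beginning with its first member \<open>2 ^ n - 1\<close>. That number is
  odd, except for \<open>n = 0\<close>.
\<close>

definition odd_or_zero :: "nat \<Rightarrow> bool" where
  "odd_or_zero k \<longleftrightarrow> k = 0 \<or> odd k"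

text \<open>
  The normalized indicators of every other interval, with a factor \<open>c n\<close> in group \<open>n\<close>. The
  coefficients with respect to the summing vectors are \<open>c n\<close> and \<open>- c n\<close> in turn
  (\<open>summing_coeff_alt\<close>).
\<close>

definition alt :: "(nat \<Rightarrow> 'a) \<Rightarrow> nat \<Rightarrow> 'a::real_normed_field" where
  "alt c i = (if odd_or_zero (block_of i) then c (group_of (block_of i)) * of_real (1 / block_norm (block_of i)) else 0)"

lemma block_coord_alt: "block_coord k (alt c) = (if odd_or_zero k then c (group_of k) else 0)"
  by (rule block_coord_blockwise_const) (simp add: alt_def)

lemma diff_coeff_alt: "diff_coeff j (alt c) = 0"
  by (rule diff_coeff_blockwise_const) (simp add: alt_def block_of_eq)

lemma odd_or_zero_pred:
  assumes "0 < k" "k < group_end (k - 1)"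
  shows "group_of (k - 1) = group_of k" "odd_or_zero (k - 1) \<longleftrightarrow> \<not> odd_or_zero k"
proof -
  have b: "2 ^ group_of (k - 1) - 1 \<le> k - 1" "k - 1 < 2 ^ Suc (group_of (k - 1)) - 1"
    using group_of_eq_iff[of "k - 1" "group_of (k - 1)"] by auto
  have "k < 2 ^ Suc (group_of (k - 1)) - 1"
    using assms(2) group_end_eq[OF b] by simp
  moreover have "2 ^ group_of (k - 1) - 1 \<le> k" using b(1) by linarith
  ultimately show g: "group_of (k - 1) = group_of k" using group_of_eq_iff[of k "group_of (k - 1)"] by metis
  have "k \<noteq> 1"
  proof
    assume "k = 1"
    with group_end_eq[of 0 0] assms(2) show False by simp
  qed
  with assms(1) show "odd_or_zero (k - 1) \<longleftrightarrow> \<not> odd_or_zero k" by (auto simp: odd_or_zero_def)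
qed

lemma first_of_group:
  assumes "0 < k" "\<not> k < group_end (k - 1)"
  shows "odd_or_zero k"
proof -
  have b: "2 ^ group_of (k - 1) - 1 \<le> k - 1" "k - 1 < 2 ^ Suc (group_of (k - 1)) - 1"
    using group_of_eq_iff[of "k - 1" "group_of (k - 1)"] by auto
  have "k = 2 ^ Suc (group_of (k - 1)) - 1"
    using assms group_end_eq[OF b] b(2) by linarith
  then have "odd k" by (metis One_nat_def Suc_pred even_Suc even_power even_numeral pos2 zero_less_Suc zero_less_power)
  then show ?thesis by (simp add: odd_or_zero_def)
qed

lemma summing_coeff_alt:
  "summing_coeff k (alt c) = (if odd_or_zero k then c (group_of k) else - c (group_of k))"
proof (cases "0 < k \<and> k < group_end (k - 1)")
  case True
  then show ?thesis using odd_or_zero_pred[of k] by (simp add: summing_coeff_def block_coord_alt)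
next
  case False
  then have "odd_or_zero k" using first_of_group[of k] by (cases "k = 0") (auto simp: odd_or_zero_def)
  then show ?thesis using False by (auto simp: summing_coeff_def block_coord_alt)
qed

lemma basis_coeff_alt: "basis_coeff j (alt c) =
   (if odd j then 0 else if odd_or_zero (j div 2) then c (group_of (j div 2)) else - c (group_of (j div 2)))"
  by (simp add: basis_coeff_def summing_coeff_alt diff_coeff_alt)

definition unit_at :: "nat \<Rightarrow> nat \<Rightarrow> 'a::real_normed_field" where
  "unit_at n m = (if m = n then 1 else 0)"

lemma
  shows alt_unit_X: "(alt (unit_at n) :: nat \<Rightarrow> 'a::real_normed_field) \<in> X"
    and N_alt_unit: "N (alt (unit_at n) :: nat \<Rightarrow> 'a) \<le> 3"
proof -
  let ?a = "2 ^ n - 1 :: nat"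
  have lt: "(2::nat) ^ n - 1 < 2 ^ Suc n - 1" using less_exp[of n] by (simp add: less_diff_conv)
  have ge: "group_end ?a = 2 ^ Suc n - 1" by (rule group_end_eq) (use lt in auto)
  have le: "norm (alt (unit_at n) k :: 'a) \<le> norm (block_sum ?a (2 ^ Suc n - 1) k :: 'a)" for k
    using group_of_eq_iff[of "block_of k" n] by (auto simp: alt_def unit_at_def block_sum_def)
  show "(alt (unit_at n) :: nat \<Rightarrow> 'a) \<in> X" "N (alt (unit_at n) :: nat \<Rightarrow> 'a) \<le> 3"
    using garling_comparison[OF block_sum_X le] N_block_sum_group[of ?a, where ?'a = 'a, unfolded ge] by auto
qed

definition positive_members :: "nat \<Rightarrow> nat set" where
  "positive_members n = {k. group_of k = n \<and> odd_or_zero k}"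

lemma finite_positive_members: "finite (positive_members n)"
  by (rule finite_subset[of _ "{..<2 ^ Suc n - 1}"]) (auto simp: positive_members_def group_of_eq_iff)

lemma card_positive_members: "2 ^ n \<le> 2 * card (positive_members n)"
proof (cases n)
  case 0
  have "0 \<in> positive_members 0" by (simp add: positive_members_def group_of_def odd_or_zero_def)
  then have "card (positive_members 0) \<noteq> 0" using finite_positive_members[of 0] by auto
  then show ?thesis using 0 by simp
next
  case (Suc m)
  define a :: nat where "a = 2 ^ n - 1"
  have a: "odd a" "a + 2 * 2 ^ m = 2 ^ Suc n - 1" using Suc by (auto simp: a_def)
  have "(\<lambda>i. a + 2 * i) ` {..<2 ^ m} \<subseteq> positive_members n"
    unfolding positive_members_def group_of_eq_iff a(2)[symmetric] a_def[symmetric]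
    using a(1) by (auto simp: odd_or_zero_def)
  from card_mono[OF finite_positive_members this] have "2 ^ m \<le> card (positive_members n)"
    by (simp add: card_image inj_on_def)
  then show ?thesis using Suc by simp
qed

text \<open>
  All summing vectors of a group contain the last normalized indicator of the group, so there
  their coefficients add up.
\<close>

lemma N_sum_positive_members:
  fixes c :: "'a::real_normed_field"
  shows "norm c * 2 ^ n \<le> 4 * N (\<lambda>i. \<Sum>k\<in>positive_members n. c * summing_vec k i)"
proof -
  let ?l = "2 ^ Suc n - 2 :: nat"
  have S: "(\<lambda>i. \<Sum>k\<in>positive_members n. c * summing_vec k i) \<in> X" by (intro X_sum X_scale summing_vec_X)
  have add: "block_coord ?l (\<lambda>i. \<Sum>k\<in>I. c * summing_vec k i) = (\<Sum>k\<in>I. c * block_coord ?l (summing_vec k))" if "finite I" for I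
    using that by (induction I rule: finite_induct)
      (simp_all add: block_coord_def avg_add avg_scale avg_zero algebra_simps)
  have one: "block_coord ?l (summing_vec k) = (1 :: 'a)" if "k \<in> positive_members n" for k
  proof -
    have b: "2 ^ n - 1 \<le> k" "k < 2 ^ Suc n - 1" using that by (auto simp: positive_members_def group_of_eq_iff)
    then have "k \<le> ?l" "?l < 2 ^ Suc n - 1" by linarith+
    then show ?thesis unfolding block_coord_summing_vec group_end_eq[OF b] by simp
  qed
  have "block_coord ?l (\<lambda>i. \<Sum>k\<in>positive_members n. c * summing_vec k i) = of_nat (card (positive_members n)) * c"
    unfolding add[OF finite_positive_members] using one by simp
  then have "real (card (positive_members n)) * norm c \<le> 2 * N (\<lambda>i. \<Sum>k\<in>positive_members n. c * summing_vec k i)"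
    using norm_block_coord_le[OF S, of ?l] by (simp add: norm_mult)
  moreover have "2 ^ n * norm c \<le> (2 * real (card (positive_members n))) * norm c"
    using of_nat_mono[OF card_positive_members[of n], where ?'a = real] by (intro mult_right_mono) auto
  ultimately show ?thesis by (simp add: mult.commute)
qed

lemma sum_even_positions:
  "(\<Sum>j\<in>(\<lambda>k. 2 * k) ` positive_members n. a j * basis_vec j i) = (\<Sum>k\<in>positive_members n. a (2 * k) * summing_vec k i)"
  by (subst sum.reindex) (auto simp: inj_on_def basis_vec_def)

section \<open>The growth of the coordinate projections\<close>

lemma L_const_upper:
  "L_const X N (basis_vec :: nat \<Rightarrow> nat \<Rightarrow> 'a::real_normed_field) m \<le> ennreal 32 * of_nat m"
  unfolding L_const_def
proof (rule Sup_least, clarify)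
  fix f :: "nat \<Rightarrow> 'a" and A
  assume f: "f \<in> X" and s: "supp N basis_vec f \<subseteq> {..<m}"
  let ?D = "A \<inter> supp N basis_vec f"
  have "card ?D \<le> card {..<m}" by (rule card_mono) (use s in auto)
  then have card: "card ?D \<le> m" by simp
  have "N (coord_proj N basis_vec A f) \<le> (\<Sum>j\<in>?D. N (\<lambda>k. basis_coeff j f * basis_vec j k))"
    unfolding coord_proj_def coeffs_basis_vec[OF f] by (intro N_sum X_scale basis_vec_X)
  also have "\<dots> \<le> (\<Sum>j\<in>?D. 32 * N f)"
  proof (rule sum_mono)
    fix j
    have "N (\<lambda>k. basis_coeff j f * basis_vec j k) \<le> norm (basis_coeff j f) * N (basis_vec j :: nat \<Rightarrow> 'a)"
      by (rule N_scale_le[OF basis_vec_X])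
    also have "\<dots> \<le> (4 * N f) * 8"
      using norm_basis_coeff_le[OF f] N_basis_vec N_nonneg[OF f] N_nonneg[OF basis_vec_X] by (intro mult_mono) auto
    finally show "N (\<lambda>k. basis_coeff j f * basis_vec j k) \<le> 32 * N f" by simp
  qed
  also have "\<dots> \<le> m * (32 * N f)"
    using card N_nonneg[OF f] by (simp add: mult_right_mono)
  finally have "N (coord_proj N basis_vec A f) \<le> 32 * m * N f" by simp
  then have "N (coord_proj N basis_vec A f) / N f \<le> 32 * real m"
    using N_nonneg[OF f] by (cases "N f = 0") (auto simp: divide_le_eq)
  then have "ennreal (N (coord_proj N basis_vec A f) / N f) \<le> ennreal (32 * real m)"
    by (rule ennreal_leI)
  also have "\<dots> = ennreal 32 * of_nat m" by (simp add: ennreal_mult ennreal_of_nat_eq_real_of_nat)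
  finally show "ennreal (N (coord_proj N basis_vec A f) / N f) \<le> ennreal 32 * of_nat m" .
qed

text \<open>
  The test vector is the alternating sum over the last group \<open>n\<close> whose summing vectors all occur
  among the first \<open>m\<close> basis vectors; the largest of their positions is \<open>2 ^ (n + 2) - 4\<close>.
  Projecting onto the positive terms raises the norm from at most 3 to at least \<open>2 ^ n / 4\<close>, and
  \<open>m < 8 * 2 ^ n\<close>.
\<close>

lemma L_const_lower:
  assumes "1 \<le> m"
  shows "of_nat m \<le> ennreal 96 * L_const X N (basis_vec :: nat \<Rightarrow> nat \<Rightarrow> 'a::real_normed_field) m"
proof -
  define n where "n = floor_log (m + 3) - 2"
  have "2 \<le> floor_log (m + 3)" using floor_log_le_iff[of "2 ^ 2" "m + 3"] assms
    by (simp only: floor_log_power) simp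
  then have fl: "floor_log (m + 3) = n + 2" by (simp add: n_def)
  have n: "2 ^ (n + 2) \<le> m + 3" "m + 3 < 2 ^ (n + 3)"
    using floor_log_exp2_le[of "m + 3"] floor_log_exp2_gt[of "m + 3"] by (auto simp: fl power_add)
  define f :: "nat \<Rightarrow> 'a" where "f = alt (unit_at n)"
  have f: "f \<in> X" by (simp add: f_def alt_unit_X)
  define A where "A = (\<lambda>k. 2 * k) ` positive_members n"
  have bf: "basis_coeff j f \<noteq> 0 \<longleftrightarrow> even j \<and> group_of (j div 2) = n" for j
    by (simp add: f_def basis_coeff_alt unit_at_def)
  have supp: "supp N basis_vec f \<subseteq> {..<m}"
  proof
    fix j assume "j \<in> supp N basis_vec f"
    then have "even j" "j div 2 < 2 ^ Suc n - 1" by (auto simp: supp_basis_vec[OF f] bf group_of_eq_iff)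
    then show "j \<in> {..<m}" using n(1) by auto
  qed
  have AE: "A \<inter> supp N basis_vec f = (\<lambda>k. 2 * k) ` positive_members n" by (auto simp: A_def supp_basis_vec[OF f] bf positive_members_def)
  have one: "basis_coeff (2 * k) f = 1" if "k \<in> positive_members n" for k
    using that by (simp add: f_def basis_coeff_alt unit_at_def positive_members_def)
  have cp: "coord_proj N basis_vec A f = (\<lambda>i. \<Sum>k\<in>positive_members n. 1 * summing_vec k i)"
    unfolding coord_proj_def AE coeffs_basis_vec[OF f] sum_even_positions by (intro ext sum.cong) (auto simp: one)
  have big: "2 ^ n \<le> 4 * N (coord_proj N basis_vec A f)"
    using N_sum_positive_members[of "1 :: 'a" n] by (simp add: cp)
  have ne: "f \<noteq> (\<lambda>_. 0)"
  proof
    assume "f = (\<lambda>_. 0)"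
    then have "\<not> (\<exists>j. basis_coeff j f \<noteq> 0)" by (simp add: basis_coeff_zero)
    moreover have "positive_members n \<noteq> {}" using card_positive_members[of n] by (metis card.empty mult_0_right not_exp_less_eq_0_int of_nat_0 le_zero_eq power_eq_0_iff zero_neq_numeral)
    ultimately show False using one by force
  qed
  then obtain i where "f i \<noteq> 0" by auto
  then have pos: "0 < N f" using norm_le_N[OF f, of i] zero_less_norm_iff[of "f i"] by linarith
  have le3: "N f \<le> 3" by (simp add: f_def N_alt_unit)
  have "m < 8 * 2 ^ n" using n(2) by (simp add: power_add)
  then have "real m < real (8 * 2 ^ n)" by (simp only: of_nat_less_iff)
  then have "real m < 8 * 2 ^ n" by simp
  also have "\<dots> \<le> 32 * N (coord_proj N basis_vec A f)" using big by simp
  also have "\<dots> \<le> 96 * (N (coord_proj N basis_vec A f) / N f)"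
  proof -
    have "0 \<le> N (coord_proj N basis_vec A f)" using big zero_le_power[of "2::real" n] by linarith
    then have "N (coord_proj N basis_vec A f) * N f \<le> N (coord_proj N basis_vec A f) * 3"
      using le3 by (intro mult_left_mono)
    then show ?thesis using pos by (simp add: le_divide_eq mult.commute)
  qed
  finally have "real m \<le> 96 * (N (coord_proj N basis_vec A f) / N f)" by simp
  then have "ennreal (real m) \<le> ennreal (96 * (N (coord_proj N basis_vec A f) / N f))" by (rule ennreal_leI)
  also have "\<dots> = ennreal 96 * ennreal (N (coord_proj N basis_vec A f) / N f)" by (rule ennreal_mult') simp
  also have "\<dots> \<le> ennreal 96 * L_const X N (basis_vec :: nat \<Rightarrow> nat \<Rightarrow> 'a) m"
    unfolding L_const_def by (intro mult_left_mono Sup_upper) (use f ne supp in auto)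
  finally show ?thesis by (simp add: ennreal_of_nat_eq_real_of_nat)
qed

lemma L_const_equivalent:
  "equivalent_families (L_const X N (basis_vec :: nat \<Rightarrow> nat \<Rightarrow> 'a::real_normed_field)) of_nat"
  unfolding equivalent_families_def
proof (intro exI[of _ "96::real"] conjI allI impI)
  fix m :: nat
  assume "1 \<le> m"
  show "L_const X N (basis_vec :: nat \<Rightarrow> nat \<Rightarrow> 'a) m \<le> ennreal 96 * of_nat m"
    by (rule order_trans[OF L_const_upper mult_right_mono]) (auto intro: ennreal_leI)
  show "of_nat m \<le> ennreal 96 * L_const X N (basis_vec :: nat \<Rightarrow> nat \<Rightarrow> 'a) m"
    by (rule L_const_lower) fact
qed simp

end

section \<open>Conditionality\<close>

text \<open>
  A prescribed part of every block is brought to the front of the block, so that it occupies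
  consecutive positions and appears as a difference of two partial sums.
\<close>

lemma blockwise_permutation:
  fixes l :: "nat \<Rightarrow> nat"
  assumes l: "strict_mono l" "l 0 = 0" and E: "\<And>n. E n \<subseteq> {l n..<l (Suc n)}"
  obtains \<pi> where "bij \<pi>" and "\<And>n. bij_betw \<pi> {l n..<l n + card (E n)} (E n)"
proof -
  define J where "J n = {l n..<l (Suc n)}" for n
  define F where "F n = {l n..<l n + card (E n)}" for n
  have FJ: "F n \<subseteq> J n" for n
    using card_mono[OF _ E[of n]] strict_monoD[OF l(1), of n "Suc n"] by (auto simp: F_def J_def)
  have fin: "finite (J n)" "finite (F n)" "finite (E n)" for n
    using E[of n] finite_subset by (auto simp: J_def F_def)
  have "\<exists>\<rho>. bij_betw \<rho> (J n) (J n) \<and> bij_betw \<rho> (F n) (E n)" for n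
  proof -
    have "card (F n) = card (E n)" by (simp add: F_def)
    then obtain a where a: "bij_betw a (F n) (E n)" using fin finite_same_card_bij by blast
    have EJ: "E n \<subseteq> J n" using E by (simp add: J_def)
    have "card (J n - F n) = card (J n - E n)"
      using fin FJ[of n] EJ \<open>card (F n) = card (E n)\<close> by (simp add: card_Diff_subset)
    then obtain b where b: "bij_betw b (J n - F n) (J n - E n)" using fin finite_same_card_bij finite_Diff by metis
    have "bij_betw (\<lambda>x. if x \<in> F n then a x else b x) (F n \<union> (J n - F n)) (E n \<union> (J n - E n))"
      by (rule bij_betw_disjoint_Un[OF a b]) auto
    moreover have "F n \<union> (J n - F n) = J n" "E n \<union> (J n - E n) = J n" using FJ EJ by auto
    moreover have "bij_betw (\<lambda>x. if x \<in> F n then a x else b x) (F n) (E n)"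
      using a by (simp cong: bij_betw_cong)
    ultimately show ?thesis by auto
  qed
  then obtain \<rho> where \<rho>: "\<And>n. bij_betw (\<rho> n) (J n) (J n)" "\<And>n. bij_betw (\<rho> n) (F n) (E n)" by metis
  define \<beta> where "\<beta> j = (LEAST n. j < l (Suc n))" for j
  have \<beta>: "\<beta> j = n" if "j \<in> J n" for j n
    unfolding \<beta>_def
  proof (rule Least_equality)
    show "j < l (Suc n)" using that by (simp add: J_def)
    fix m assume "j < l (Suc m)"
    then have "l n < l (Suc m)" using that by (simp add: J_def)
    then show "n \<le> m" using l(1) by (simp add: strict_mono_less)
  qed
  have cover: "j \<in> J (\<beta> j)" for j
  proof -
    have "j < l (Suc j)" using strict_mono_imp_increasing[OF l(1), of "Suc j"] by simp
    then have 1: "j < l (Suc (\<beta> j))" unfolding \<beta>_def by (rule LeastI)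
    have 2: "l (\<beta> j) \<le> j"
    proof (cases "\<beta> j")
      case (Suc m)
      then show ?thesis using not_less_Least[of m "\<lambda>n. j < l (Suc n)"] by (simp add: \<beta>_def)
    qed (simp add: l)
    from 1 2 show ?thesis by (simp add: J_def)
  qed
  define \<pi> where "\<pi> j = \<rho> (\<beta> j) j" for j
  have \<pi>: "bij_betw \<pi> S S' \<longleftrightarrow> bij_betw (\<rho> n) S S'" if "S \<subseteq> J n" for S S' n
    by (rule bij_betw_cong) (use that \<beta> in \<open>auto simp: \<pi>_def\<close>)
  have "bij_betw \<pi> (\<Union>n\<in>UNIV. J n) (\<Union>n\<in>UNIV. J n)"
  proof (rule bij_betw_UNION_disjoint)
    show "disjoint_family_on J UNIV" using \<beta> unfolding disjoint_family_on_def by blast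
    show "bij_betw \<pi> (J n) (J n)" for n using \<pi>[OF order_refl] \<rho>(1) by simp
  qed
  moreover have "(\<Union>n\<in>UNIV. J n) = UNIV" using cover by auto
  ultimately have "bij \<pi>" by simp
  then show thesis by (rule that) (use \<pi>[OF FJ] \<rho>(2) in \<open>simp add: F_def\<close>)
qed

context garling_blocks
begin

definition alternating_sum :: "nat \<Rightarrow> 'a::real_normed_field" where
  "alternating_sum = alt (\<lambda>n. of_real ((1/2) ^ n))"

text \<open>
  On a finite set of coordinates the sequence agrees with a finite sum over the groups, so the
  bound follows from the triangle inequality and the geometric series.
\<close>

lemma alternating_sum_X: "(alternating_sum :: nat \<Rightarrow> 'a::real_normed_field) \<in> X"
proof (rule garling_boundI(1)[of 6])
  fix A :: "nat set" assume A: "finite A"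
  obtain n where n: "\<And>a. a \<in> A \<Longrightarrow> group_of (block_of a) < n"
    using A finite_nat_set_iff_bounded[of "(\<lambda>a. group_of (block_of a)) ` A"] by auto
  let ?g = "\<lambda>i. \<Sum>m<n. of_real ((1/2) ^ m) * alt (unit_at m) i :: 'a"
  have g: "?g \<in> X" by (intro X_sum X_scale alt_unit_X)
  have "N ?g \<le> (\<Sum>m<n. N (\<lambda>i. of_real ((1/2) ^ m) * alt (unit_at m) i :: 'a))"
    by (intro N_sum X_scale alt_unit_X)
  also have "\<dots> \<le> (\<Sum>m<n. (1/2) ^ m * 3)"
  proof (rule sum_mono)
    fix m
    have "N (\<lambda>i. of_real ((1/2) ^ m) * alt (unit_at m) i :: 'a)
        \<le> norm (of_real ((1/2) ^ m) :: 'a) * N (alt (unit_at m) :: nat \<Rightarrow> 'a)"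
      by (rule N_scale_le[OF alt_unit_X])
    also have "norm (of_real ((1/2) ^ m) :: 'a) = (1/2) ^ m" by (simp only: norm_of_real) simp
    also have "(1/2) ^ m * N (alt (unit_at m) :: nat \<Rightarrow> 'a) \<le> (1/2) ^ m * 3"
      by (intro mult_left_mono N_alt_unit) simp
    finally show "N (\<lambda>i. of_real ((1/2) ^ m) * alt (unit_at m) i :: 'a) \<le> (1/2) ^ m * 3" .
  qed
  also have "\<dots> = 6 - 6 * (1/2) ^ n"
    by (simp add: sum_distrib_right[symmetric] sum_gp_strict)
  also have "\<dots> \<le> 6" by simp
  finally have Ng: "N ?g \<le> 6" .
  have "alternating_sum a = ?g a" if "a \<in> A" for a
  proof -
    have "?g a = (\<Sum>m<n. if m = group_of (block_of a) then alternating_sum a else 0)"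
      by (rule sum.cong) (auto simp: alternating_sum_def alt_def unit_at_def)
    then show ?thesis using n[OF that] by simp
  qed
  then have "wsum (alternating_sum :: nat \<Rightarrow> 'a) A = wsum ?g A" by (intro wsum_cong) simp
  also have "\<dots> \<le> N ?g powr p" by (rule wsum_le_N[OF g A])
  also have "\<dots> \<le> 6 powr p" by (intro powr_p_mono Ng N_nonneg g)
  finally show "wsum (alternating_sum :: nat \<Rightarrow> 'a) A \<le> 6 powr p" .
qed simp

text \<open>
  After the permutation, the partial sums up to \<open>l n\<close> and up to \<open>l n + card (D n)\<close> differ by
  \<open>(1/2) ^ n\<close> times the sum of at least \<open>2 ^ n / 2\<close> summing vectors of one group. This difference
  has norm at least \<open>1/4\<close>, so the partial sums are not Cauchy.
\<close>

lemma not_unconditional: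
  "\<not> unconditional_basis X N (basis_vec :: nat \<Rightarrow> nat \<Rightarrow> 'a::real_normed_field)"
proof
  assume unc: "unconditional_basis X N (basis_vec :: nat \<Rightarrow> nat \<Rightarrow> 'a)"
  let ?f = "alternating_sum :: nat \<Rightarrow> 'a"
  define l :: "nat \<Rightarrow> nat" where "l n = 2 * (2 ^ n - 1)" for n
  define D where "D n = (\<lambda>k. 2 * k) ` positive_members n" for n
  have l: "strict_mono l"
    unfolding strict_mono_Suc_iff l_def using one_le_power[of "2::nat"] by (auto simp: less_diff_conv)
  have DJ: "D n \<subseteq> {l n..<l (Suc n)}" for n by (auto simp: D_def positive_members_def group_of_eq_iff l_def)
  obtain \<pi> where \<pi>: "bij \<pi>" "\<And>n. bij_betw \<pi> {l n..<l n + card (D n)} (D n)"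
    using blockwise_permutation[OF l _ DJ] by (auto simp: l_def)
  define u where "u j = (\<lambda>k. basis_coeff (\<pi> j) ?f * basis_vec (\<pi> j) k)" for j
  obtain g where g: "g \<in> X" "series_converges_to N u g"
  proof -
    have "\<forall>f\<in>X. \<forall>\<pi>. bij \<pi> \<longrightarrow>
        (\<exists>g\<in>X. series_converges_to N (\<lambda>j k. coeffs N basis_vec f (\<pi> j) * basis_vec (\<pi> j) k :: 'a) g)"
      using unc unfolding unconditional_basis_def by (rule conjunct2)
    from this[rule_format, OF alternating_sum_X \<pi>(1)]
    obtain g where "g \<in> X" "series_converges_to N (\<lambda>j k. coeffs N basis_vec ?f (\<pi> j) * basis_vec (\<pi> j) k) g" ..
    moreover have "u = (\<lambda>j k. coeffs N basis_vec ?f (\<pi> j) * basis_vec (\<pi> j) k)"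
      by (simp add: u_def fun_eq_iff coeffs_basis_vec[OF alternating_sum_X])
    ultimately show ?thesis using that[of g] by simp
  qed
  define S where "S n = (\<lambda>k. \<Sum>j<n. u j k)" for n
  have uX: "u j \<in> X" for j unfolding u_def by (rule X_scale[OF basis_vec_X])
  have rX: "(\<lambda>k. g k - S n k) \<in> X" for n unfolding S_def by (intro X_diff g X_sum uX)
  have "(\<lambda>n. N (\<lambda>k. g k - S n k)) \<longlonglongrightarrow> 0"
    using g(2) by (simp add: series_converges_to_def S_def)
  then have "\<forall>\<^sub>F n in sequentially. N (\<lambda>k. g k - S n k) < 1/8" by (intro order_tendstoD) auto
  then obtain n where n: "\<And>m. n \<le> m \<Longrightarrow> N (\<lambda>k. g k - S m k) < 1/8"
    by (auto simp: eventually_sequentially)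
  let ?a = "l n" and ?b = "l n + card (D n)"
  have "n \<le> ?a" using strict_mono_imp_increasing[OF l] .
  have window: "S ?b k - S ?a k = (\<Sum>i\<in>positive_members n. of_real ((1/2) ^ n) * summing_vec i k)" for k
  proof -
    have "{..<?b} = {..<?a} \<union> {?a..<?b}" by auto
    then have "S ?b k - S ?a k = (\<Sum>j\<in>{?a..<?b}. u j k)"
      unfolding S_def by (simp add: sum.union_disjoint ivl_disj_int)
    also have "\<dots> = (\<Sum>j\<in>D n. basis_coeff j ?f * basis_vec j k)"
      unfolding u_def by (rule sum.reindex_bij_betw[OF \<pi>(2)])
    also have "\<dots> = (\<Sum>i\<in>positive_members n. basis_coeff (2 * i) ?f * summing_vec i k)"
      unfolding D_def by (rule sum_even_positions)
    also have "\<dots> = (\<Sum>i\<in>positive_members n. of_real ((1/2) ^ n) * summing_vec i k)"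
      by (rule sum.cong) (auto simp: alternating_sum_def basis_coeff_alt positive_members_def)
    finally show ?thesis .
  qed
  have "norm (of_real ((1/2) ^ n) :: 'a) * 2 ^ n \<le> 4 * N (\<lambda>k. \<Sum>i\<in>positive_members n. of_real ((1/2) ^ n) * summing_vec i k :: 'a)"
    by (rule N_sum_positive_members)
  moreover have "norm (of_real ((1/2) ^ n) :: 'a) * 2 ^ n = 1"
    by (simp only: norm_of_real) (simp add: power_divide)
  moreover have "(\<lambda>k. \<Sum>i\<in>positive_members n. of_real ((1/2) ^ n) * summing_vec i k) = (\<lambda>k. (g k - S ?a k) - (g k - S ?b k))"
    by (simp only: window[symmetric]) simp
  ultimately have "1 \<le> 4 * N (\<lambda>k. (g k - S ?a k) - (g k - S ?b k))" by simp
  also have "\<dots> \<le> 4 * (N (\<lambda>k. g k - S ?a k) + N (\<lambda>k. g k - S ?b k))"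
    by (intro mult_left_mono N_diff rX) simp
  also have "\<dots> < 4 * (1/8 + 1/8)" using n[of ?a] n[of ?b] \<open>n \<le> ?a\<close> by simp
  finally show False by simp
qed

lemma conditional_basis_vec: "conditional_basis X N basis_vec"
  by (simp add: conditional_basis_def schauder_basis_vec not_unconditional)

end

theorem proposition3p1:
  fixes p :: real and w :: "nat \<Rightarrow> real"
  assumes "1 \<le> p" and "weight w"
  shows "(\<exists>B :: nat \<Rightarrow> nat \<Rightarrow> real.
            conditional_basis (garling_space w p) (garling_norm w p) B \<and>
            equivalent_families (L_const (garling_space w p) (garling_norm w p) B) of_nat) \<and>
         (\<exists>B :: nat \<Rightarrow> nat \<Rightarrow> complex.
            conditional_basis (garling_space w p) (garling_norm w p) B \<and>
            equivalent_families (L_const (garling_space w p) (garling_norm w p) B) of_nat)"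
proof -
  interpret garling_weight w p by unfold_locales (use assms in auto)
  obtain q t :: "nat \<Rightarrow> nat" where qt: "\<forall>r. 2 \<le> q r" "\<forall>r s. r < s \<longrightarrow> q r * w (t s) \<le> (1/2) ^ r"
    "\<forall>r. weight_sum (t r) \<le> (1/2) ^ r * weight_sum (q r)"
    using separated_lengths_exist by (elim exE conjE)
  interpret garling_blocks w p q t by unfold_locales (rule qt[rule_format]; assumption?)+
  show ?thesis by (intro conjI exI) (rule conditional_basis_vec L_const_equivalent)+
qed

end
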